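(* Let $n=2^l(2m+1)$ with integers $l,m\ge 0$, and put $k=2^{l+1}-1$. Let $\mathcal C_n$ denote either the set of all nonempty compact subsets of $\mathbb R^n$, or the set of all nonempty convex compact subsets of $\mathbb R^n$, with the Hausdorff metric. Let $\alpha_1,\ldots,\alpha_k:\mathcal C_n\to\mathbb R$ be continuous $O(n)$-invariant functions. Let $K\subseteq\mathbb R^{2n}$ be a nonempty compact set (respectively, a nonempty convex compact set). Then there exists a pair of orthogonal $n$-dimensional linear subspaces $L$ and $M$ of $\mathbb R^{2n}$ such that, for the orthogonal projections $\pi_L$ and $\pi_M$ onto $L$ and $M$, $$\alpha_i(\pi_L(K))=\alpha_i(\pi_M(K))\qquad\text{for all } i=1,\ldots,k.$$
   Context: A function $\alpha$ on $\mathcal C_n$ is $O(n)$-invariant if $\alpha(gC)=\alpha(C)$ for all $g\in O(n)$ and $C\in\mathcal C_n$. For an $n$-dimensional linear subspace $L\subset\mathbb R^{2n}$ and a (convex) compact set $C\subset L$, the value $\alpha(C)$ means $\alpha(\phi(C))$, where $\phi:L\to\mathbb R^n$ is any linear isometry; by $O(n)$-invariance this does not depend on the choice of $\phi$. *)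

theory Defs
  imports "HOL-Analysis.Analysis"
begin

definition nonempty_compacts :: "'a::euclidean_space set set"
  where "nonempty_compacts = {C. C \<noteq> {} \<and> compact C}"

definition nonempty_convex_compacts :: "'a::euclidean_space set set"
  where "nonempty_convex_compacts = {C. C \<noteq> {} \<and> compact C \<and> convex C}"

text \<open>The guard only serves to make the function symmetric and nonnegative on all
  pairs of sets, as the locale \<^locale>\<open>Metric_space\<close> requires.\<close>

definition hausdorff_dist :: "'a::metric_space set \<Rightarrow> 'a set \<Rightarrow> real"
  where "hausdorff_dist A B =
    (if A \<noteq> {} \<and> B \<noteq> {} \<and> bounded A \<and> bounded B
     then max (SUP a\<in>A. infdist a B) (SUP b\<in>B. infdist b A) else 0)"

lemma bdd_above_infdist:
  assumes "bounded A" "B \<noteq> {}"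
  shows "bdd_above ((\<lambda>a. infdist a B) ` A)"
proof -
  obtain b where b: "b \<in> B" using assms by auto
  obtain e where e: "\<And>a. a \<in> A \<Longrightarrow> dist b a \<le> e"
    using assms(1) unfolding bounded_any_center[of A b] by auto
  show ?thesis
  proof (rule bdd_aboveI2)
    fix a assume "a \<in> A"
    then show "infdist a B \<le> e"
      using infdist_le[OF b, of a] e[of a] by (simp add: dist_commute)
  qed
qed

lemma infdist_le_hausdorff_dist:
  assumes "bounded A" "bounded B" "B \<noteq> {}" "a \<in> A"
  shows "infdist a B \<le> hausdorff_dist A B"
proof -
  have "infdist a B \<le> (SUP a\<in>A. infdist a B)"
    using assms by (intro cSUP_upper bdd_above_infdist)
  then show ?thesis using assms unfolding hausdorff_dist_def by auto
qed

lemma hausdorff_dist_commute: "hausdorff_dist A B = hausdorff_dist B A"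
  unfolding hausdorff_dist_def by (auto simp: max.commute)

lemma hausdorff_dist_leI:
  assumes "A \<noteq> {}" "B \<noteq> {}" "bounded A" "bounded B"
    and "\<And>a. a \<in> A \<Longrightarrow> infdist a B \<le> e" "\<And>b. b \<in> B \<Longrightarrow> infdist b A \<le> e"
  shows "hausdorff_dist A B \<le> e"
  unfolding hausdorff_dist_def using assms by (auto intro!: cSUP_least)

lemma hausdorff_dist_nonneg: "0 \<le> hausdorff_dist A B"
proof (cases "A \<noteq> {} \<and> B \<noteq> {} \<and> bounded A \<and> bounded B")
  case True
  then obtain a where "a \<in> A" by auto
  then show ?thesis
    using True infdist_le_hausdorff_dist[of A B a] infdist_nonneg[of a B] by linarith
qed (auto simp: hausdorff_dist_def)

lemma infdist_hausdorff_triangle: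
  assumes "B \<noteq> {}" "bounded B" "C \<noteq> {}" "bounded C" "bounded A" "a \<in> A"
  shows "infdist a C \<le> hausdorff_dist A B + hausdorff_dist B C"
proof -
  have "infdist a C - hausdorff_dist B C \<le> dist a b" if "b \<in> B" for b
    using infdist_triangle[of a C b] infdist_le_hausdorff_dist[of B C b] assms that by linarith
  then have "infdist a C - hausdorff_dist B C \<le> infdist a B"
    using assms(1) by (simp add: infdist_notempty cINF_greatest)
  then show ?thesis
    using infdist_le_hausdorff_dist[of A B a] assms by linarith
qed

lemma Metric_space_nonempty_compacts: "Metric_space nonempty_compacts hausdorff_dist"
proof
  fix A B C :: "'a set"
  show "0 \<le> hausdorff_dist A B" by (rule hausdorff_dist_nonneg)
  show "hausdorff_dist A B = hausdorff_dist B A" by (rule hausdorff_dist_commute)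
  assume A: "A \<in> nonempty_compacts" and B: "B \<in> nonempty_compacts"
  note AB = A[unfolded nonempty_compacts_def] B[unfolded nonempty_compacts_def]
  show "hausdorff_dist A B = 0 \<longleftrightarrow> A = B"
  proof
    assume 0: "hausdorff_dist A B = 0"
    have "a \<in> B" if "a \<in> A" for a
      using infdist_le_hausdorff_dist[of A B a] that AB 0 infdist_nonneg[of a B]
      by (simp add: compact_imp_bounded compact_imp_closed in_closed_iff_infdist_zero)
    moreover have "b \<in> A" if "b \<in> B" for b
      using infdist_le_hausdorff_dist[of B A b] that AB 0 infdist_nonneg[of b A]
      by (simp add: compact_imp_bounded compact_imp_closed in_closed_iff_infdist_zero
          hausdorff_dist_commute)
    ultimately show "A = B" by blast
  next
    assume "A = B"
    then have "hausdorff_dist A B \<le> 0"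
      using AB by (intro hausdorff_dist_leI) (auto simp: compact_imp_bounded)
    then show "hausdorff_dist A B = 0" using hausdorff_dist_nonneg[of A B] by linarith
  qed
  assume C: "C \<in> nonempty_compacts"
  note ABC = AB C[unfolded nonempty_compacts_def]
  show "hausdorff_dist A C \<le> hausdorff_dist A B + hausdorff_dist B C"
  proof (rule hausdorff_dist_leI)
    fix a assume "a \<in> A"
    then show "infdist a C \<le> hausdorff_dist A B + hausdorff_dist B C"
      using ABC by (intro infdist_hausdorff_triangle) (auto simp: compact_imp_bounded)
  next
    fix c assume "c \<in> C"
    then have "infdist c A \<le> hausdorff_dist C B + hausdorff_dist B A"
      using ABC by (intro infdist_hausdorff_triangle) (auto simp: compact_imp_bounded)
    then show "infdist c A \<le> hausdorff_dist A B + hausdorff_dist B C"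
      by (simp add: hausdorff_dist_commute)
  qed (use ABC in \<open>auto simp: compact_imp_bounded\<close>)
qed

lemma Metric_space_nonempty_convex_compacts:
  "Metric_space nonempty_convex_compacts hausdorff_dist"
  by (rule Metric_space.subspace[OF Metric_space_nonempty_compacts])
    (auto simp: nonempty_compacts_def nonempty_convex_compacts_def)


definition orth_invariant_on :: "(real^'n) set set \<Rightarrow> ((real^'n) set \<Rightarrow> real) \<Rightarrow> bool"
  where "orth_invariant_on \<C> \<alpha> \<longleftrightarrow>
    (\<forall>g. orthogonal_transformation g \<longrightarrow> (\<forall>C\<in>\<C>. \<alpha> (g ` C) = \<alpha> C))"

definition orth_proj :: "'a::euclidean_space set \<Rightarrow> 'a \<Rightarrow> 'a"
  where "orth_proj L x = (THE y. y \<in> L \<and> (\<forall>z\<in>L. orthogonal (x - y) z))"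

lemma orth_proj_unique:
  assumes "subspace L" "y \<in> L" "\<And>z. z \<in> L \<Longrightarrow> orthogonal (x - y) z"
  shows "orth_proj L x = y"
  unfolding orth_proj_def
proof (rule the_equality)
  fix y' assume y': "y' \<in> L \<and> (\<forall>z\<in>L. orthogonal (x - y') z)"
  then have "y' - y \<in> L" using assms by (simp add: subspace_diff)
  then have "orthogonal (x - y) (y' - y)" "orthogonal (x - y') (y' - y)"
    using assms y' by auto
  then have "(y' - y) \<bullet> (y' - y) = 0"
    unfolding orthogonal_def by (simp add: inner_diff_left)
  then show "y' = y" by simp
qed (use assms in auto)

lemma
  assumes "subspace L"
  shows orth_proj_in: "orth_proj L x \<in> L"
    and orth_proj_orthogonal: "z \<in> L \<Longrightarrow> orthogonal (x - orth_proj L x) z"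
proof -
  obtain y w where "y \<in> span L" "\<And>z. z \<in> span L \<Longrightarrow> orthogonal w z" "x = y + w"
    using orthogonal_subspace_decomp_exists[of L x] by blast
  then have y: "y \<in> L" "\<And>z. z \<in> L \<Longrightarrow> orthogonal (x - y) z"
    using span_eq_iff[THEN iffD2, OF assms] by auto
  with orth_proj_unique[OF assms, of y x]
  show "orth_proj L x \<in> L" "z \<in> L \<Longrightarrow> orthogonal (x - orth_proj L x) z" by auto
qed

text \<open>A linear map on a subspace is represented by a linear map on the whole space, of
  which only the restriction matters.\<close>

definition linear_isometry_on :: "'a::euclidean_space set \<Rightarrow> ('a \<Rightarrow> 'b::euclidean_space) \<Rightarrow> bool"
  where "linear_isometry_on L \<phi> \<longleftrightarrow> linear \<phi> \<and> (\<forall>x\<in>L. norm (\<phi> x) = norm x)"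

text \<open>The value \<open>\<alpha>(C)\<close> for \<open>C \<subseteq> L\<close>; the choice of the isometry is immaterial by
  \<open>value_on_eq\<close> below.\<close>

definition value_on :: "((real^'n) set \<Rightarrow> real) \<Rightarrow> 'a::euclidean_space set \<Rightarrow> 'a set \<Rightarrow> real"
  where "value_on \<alpha> L C = \<alpha> ((SOME \<phi>. linear_isometry_on L \<phi>) ` C)"

lemma linear_isometry_on_exists:
  fixes L :: "'a::euclidean_space set"
  assumes "subspace L" "dim L = DIM('b::euclidean_space)"
  shows "\<exists>\<phi> :: 'a \<Rightarrow> 'b. linear_isometry_on L \<phi>"
proof -
  obtain f :: "'a \<Rightarrow> 'b" where "linear f" "\<And>x. x \<in> L \<Longrightarrow> norm (f x) = norm x"
    using isometry_subset_subspace[of L "UNIV :: 'b set"] assms by auto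
  then show ?thesis unfolding linear_isometry_on_def by blast
qed

lemma value_on_eq:
  fixes \<alpha> :: "(real^'n) set \<Rightarrow> real" and L :: "'a::euclidean_space set"
  assumes inv: "orth_invariant_on \<C> \<alpha>"
    and \<C>: "\<C> = nonempty_compacts \<and> C \<in> nonempty_compacts
      \<or> \<C> = nonempty_convex_compacts \<and> C \<in> nonempty_convex_compacts"
    and L: "subspace L" "dim L = CARD('n)" and CL: "C \<subseteq> L"
    and \<phi>: "linear_isometry_on L \<phi>"
  shows "value_on \<alpha> L C = \<alpha> (\<phi> ` C)"
proof -
  define \<psi> :: "'a \<Rightarrow> real^'n" where "\<psi> = (SOME \<phi>. linear_isometry_on L \<phi>)"
  have "\<exists>\<phi> :: 'a \<Rightarrow> real^'n. linear_isometry_on L \<phi>"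
    using L by (intro linear_isometry_on_exists) auto
  then have "linear_isometry_on L \<psi>"
    unfolding \<psi>_def by (rule someI_ex)
  then have lin: "linear \<psi>" and iso: "\<And>x. x \<in> L \<Longrightarrow> norm (\<psi> x) = norm x"
    unfolding linear_isometry_on_def by auto
  have inj: "inj_on \<psi> L"
  proof (rule inj_onI)
    fix x y assume "x \<in> L" "y \<in> L" "\<psi> x = \<psi> y"
    then show "x = y" using iso[of "x - y"] L(1) by (simp add: subspace_diff linear_diff[OF lin])
  qed
  then have "dim (\<psi> ` L) = dim L"
    using dim_image_eq[OF lin, of L] span_eq_iff[THEN iffD2, OF L(1)] by simp
  then have "span (\<psi> ` L) = UNIV"
    using dim_eq_full[of "\<psi> ` L"] L(2) by simp
  then have surj: "\<psi> ` L = UNIV"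
    using span_eq_iff[THEN iffD2, OF linear_subspace_image[OF lin L(1)]] by simp
  obtain h where h: "linear h" "\<And>x. x \<in> L \<Longrightarrow> h (\<psi> x) = x"
    using linear_exists_left_inverse_on[OF lin L(1) inj] by auto
  have "norm (\<phi> (h v)) = norm v" for v
  proof -
    obtain x where "x \<in> L" "v = \<psi> x" using surj by blast
    then show ?thesis using h iso \<phi> by (simp add: linear_isometry_on_def)
  qed
  moreover have "linear (\<phi> \<circ> h)"
    using h(1) \<phi> by (simp add: linear_compose linear_isometry_on_def)
  ultimately have g: "orthogonal_transformation (\<phi> \<circ> h)"
    by (simp add: orthogonal_transformation)
  have "\<psi> ` C \<in> \<C>"
    using \<C> compact_continuous_image[of C \<psi>] linear_continuous_on[of \<psi> C] lin convex_linear_image[OF lin, of C]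
    unfolding nonempty_compacts_def nonempty_convex_compacts_def linear_conv_bounded_linear
    by auto
  then have "\<alpha> ((\<phi> \<circ> h) ` (\<psi> ` C)) = \<alpha> (\<psi> ` C)"
    using inv g unfolding orth_invariant_on_def by blast
  moreover have "(\<phi> \<circ> h) ` (\<psi> ` C) = \<phi> ` C"
    unfolding image_image by (rule image_cong) (use h(2) CL in auto)
  ultimately show ?thesis unfolding value_on_def \<psi>_def by simp
qed

end

theory Submission
  imports Defs "HOL-Library.Poly_Mapping" "HOL-Library.Z2"
begin

text \<open>
  Pairs \<open>(L, M)\<close> of orthogonal \<open>n\<close>-dimensional subspaces of \<open>\<real>\<^sup>2\<^sup>n\<close> correspond to symmetric matrices
  \<open>A\<close> with \<open>A\<^sup>2 = I\<close> and trace zero (\<open>L\<close> and \<open>M\<close> are the eigenspaces for \<open>1\<close> and \<open>-1\<close>), and exchanging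
  \<open>L\<close> and \<open>M\<close> is \<open>A \<mapsto> -A\<close>. So every continuous odd map from the space of these matrices to
  \<open>\<real>\<^sup>k\<close> must be shown to have a zero. As in the Borsuk--Ulam theorem, it suffices to have
  mod 2 chains \<open>c\<^sub>0, \<dots>, c\<^sub>k\<close> of arbitrarily small simplices such that \<open>c\<^sub>0\<close> is one point and
  \<open>\<partial>c\<^sub>j\<^sub>+\<^sub>1 = c\<^sub>j + \<tau>c\<^sub>j\<close>, where \<open>\<tau>\<close> is the involution: Fan's combinatorial lemma then applies.

  The chains come from a doubling construction. Rotating the block matrix \<open>diag(A, B)\<close> into
  \<open>diag(B, A)\<close> gives a path from \<open>A \<oplus> B\<close> to \<open>B \<oplus> A\<close> in the space of matrices of twice the size.
  If \<open>c\<^sub>0, \<dots>, c\<^sub>N\<^sub>-\<^sub>1\<close> are chains as above with \<open>N\<close> even, then \<open>z = c\<^sub>N\<^sub>-\<^sub>1 + \<tau>c\<^sub>N\<^sub>-\<^sub>1\<close> is a cycle, the chains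
  \<open>\<Sum>\<^sub>i c\<^sub>i \<times> \<tau>\<^sup>ic\<^sub>j\<^sub>-\<^sub>i\<close> satisfy the relations up to the error \<open>z \<times> c\<^sub>j\<^sub>-\<^sub>N + c\<^sub>j\<^sub>-\<^sub>N \<times> z\<close>, and the path
  removes this error. Hence \<open>N\<close> chains give \<open>2N\<close> chains. For \<open>n\<close> odd the half circle from
  \<open>diag(I, -I)\<close> to \<open>diag(-I, I)\<close> provides \<open>N = 2\<close>.
\<close>

section \<open>Chains with coefficients in the field with two elements\<close>

text \<open>Coefficients modulo 2 remove all signs from boundaries and products. Both
  \<open>bit\<close> and the chain groups are instances, so linear extensions into either share the
  same lemmas.\<close>

class elementary_two_group = ab_group_add +
  assumes add_self [simp]: "x + x = 0"
begin

lemma add_self_left [simp]: "x + (x + y) = y"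
  by (simp flip: add.assoc)

end

instance bit :: elementary_two_group
  by standard (simp flip: mult_2)

instance poly_mapping :: (type, elementary_two_group) elementary_two_group
  by standard (simp add: poly_mapping_eq_iff fun_eq_iff lookup_add)

type_synonym 'a chain = "'a list \<Rightarrow>\<^sub>0 bit"

text \<open>A chain is determined by its support, so summing over the support is the linear
  extension of \<open>F\<close>. It is additive when the target has exponent 2.\<close>

definition lin :: "('a \<Rightarrow> 'b::comm_monoid_add) \<Rightarrow> ('a \<Rightarrow>\<^sub>0 bit) \<Rightarrow> 'b"
  where "lin F c = sum F (Poly_Mapping.keys c)"

abbreviation gen :: "'a \<Rightarrow> 'a \<Rightarrow>\<^sub>0 bit"
  where "gen x \<equiv> Poly_Mapping.single x 1"

lemma lin_gen [simp]: "lin F (gen x) = F x"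
  by (simp add: lin_def)

lemma lin_0 [simp]: "lin F 0 = 0"
  by (simp add: lin_def)

lemma sum_sym_diff:
  fixes F :: "'a \<Rightarrow> 'b::elementary_two_group"
  assumes "finite A" "finite B"
  shows "sum F ((A - B) \<union> (B - A)) = sum F A + sum F B"
proof -
  have "sum F A = sum F (A - B) + sum F (A \<inter> B)"
    using assms by (metis add.commute sum.Int_Diff)
  moreover have "sum F B = sum F (B - A) + sum F (A \<inter> B)"
    using assms by (metis add.commute inf_commute sum.Int_Diff)
  moreover have "sum F ((A - B) \<union> (B - A)) = sum F (A - B) + sum F (B - A)"
    using assms by (intro sum.union_disjoint) auto
  ultimately show ?thesis by (simp add: ac_simps)
qed

lemma keys_add_bit:
  fixes a b :: "'a \<Rightarrow>\<^sub>0 bit"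
  shows "Poly_Mapping.keys (a + b) = (Poly_Mapping.keys a - Poly_Mapping.keys b)
    \<union> (Poly_Mapping.keys b - Poly_Mapping.keys a)"
proof (rule set_eqI)
  fix x
  show "x \<in> Poly_Mapping.keys (a + b) \<longleftrightarrow> x \<in> (Poly_Mapping.keys a - Poly_Mapping.keys b)
    \<union> (Poly_Mapping.keys b - Poly_Mapping.keys a)"
    by (cases "Poly_Mapping.lookup a x"; cases "Poly_Mapping.lookup b x") (simp_all add: in_keys_iff lookup_add)
qed

lemma lin_add [simp]:
  fixes F :: "'a \<Rightarrow> 'b::elementary_two_group"
  shows "lin F (a + b) = lin F a + lin F b"
  unfolding lin_def keys_add_bit by (rule sum_sym_diff) auto

lemma lin_sum:
  fixes F :: "'a \<Rightarrow> 'b::elementary_two_group"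
  shows "lin F (sum c I) = (\<Sum>i\<in>I. lin F (c i))"
  by (induction I rule: infinite_finite_induct) auto

lemma lin_lin:
  fixes G :: "'b \<Rightarrow> 'c::elementary_two_group"
  shows "lin G (lin F c) = lin (\<lambda>x. lin G (F x)) c"
  unfolding lin_def[of F] lin_def[of "\<lambda>x. lin G (F x)"] by (rule lin_sum)

lemma lin_fun_add: "lin (\<lambda>x. F x + G x) c = lin F c + lin G c"
  by (simp add: lin_def sum.distrib)

lemma lin_fun_zero [simp]: "lin (\<lambda>x. 0) c = 0"
  by (simp add: lin_def)

lemma lin_swap: "lin (\<lambda>x. lin (F x) b) a = lin (\<lambda>y. lin (\<lambda>x. F x y) a) b"
  unfolding lin_def by (rule sum.swap)

lemma lin_cong: "(\<And>x. x \<in> Poly_Mapping.keys c \<Longrightarrow> F x = G x) \<Longrightarrow> lin F c = lin G c"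
  by (simp add: lin_def)

lemma lin_id [simp]: "lin gen c = c"
proof (rule poly_mapping_eqI)
  fix x
  have "Poly_Mapping.lookup (lin gen c) x = (\<Sum>y\<in>Poly_Mapping.keys c. if y = x then 1 else 0)"
    unfolding lin_def lookup_sum by (intro sum.cong) (auto simp: lookup_single when_def)
  also have "\<dots> = Poly_Mapping.lookup c x"
    by (cases "Poly_Mapping.lookup c x") (auto simp: in_keys_iff)
  finally show "Poly_Mapping.lookup (lin gen c) x = Poly_Mapping.lookup c x" .
qed

lemma keys_lin: "Poly_Mapping.keys (lin F c) \<subseteq> (\<Union>x\<in>Poly_Mapping.keys c. Poly_Mapping.keys (F x))"
  unfolding lin_def by (rule keys_sum)

section \<open>Cones, boundaries and push-forwards of chains\<close>

definition cons_chain :: "'a \<Rightarrow> 'a chain \<Rightarrow> 'a chain"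
  where "cons_chain z = lin (\<lambda>zs. gen (z # zs))"

lemma cons_chain_simps [simp]:
  "cons_chain z 0 = 0"
  "cons_chain z (a + b) = cons_chain z a + cons_chain z b"
  "cons_chain z (gen zs) = gen (z # zs)"
  by (simp_all add: cons_chain_def)

lemma cons_chain_lin: "cons_chain z (lin F c) = lin (\<lambda>x. cons_chain z (F x)) c"
  by (simp add: cons_chain_def lin_lin)

lemma lin_cons_chain:
  fixes F :: "'a list \<Rightarrow> 'b::elementary_two_group"
  shows "lin F (cons_chain z c) = lin (\<lambda>zs. F (z # zs)) c"
  by (simp add: cons_chain_def lin_lin)

lemma keys_cons_chain: "Poly_Mapping.keys (cons_chain z c) \<subseteq> (#) z ` Poly_Mapping.keys c"
  unfolding cons_chain_def using keys_lin[of "\<lambda>zs. gen (z # zs)" c] by auto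

text \<open>The augmented boundary: a face drops the head, or is the cone from the head over a face
  of the tail. The empty list is the simplex of dimension -1, so a vertex has boundary
  \<open>gen []\<close>.\<close>

fun aug_faces :: "'a list \<Rightarrow> 'a chain" where
  "aug_faces [] = 0"
| "aug_faces (x # xs) = gen xs + cons_chain x (aug_faces xs)"

text \<open>The boundary is not augmented: a vertex has boundary zero.\<close>

definition faces :: "'a list \<Rightarrow> 'a chain"
  where "faces xs = (if length xs \<le> 1 then 0 else aug_faces xs)"

text \<open>The two boundaries differ only on a single vertex, and there only by
  \<open>gen []\<close>.\<close>

lemma lin_faces: "F [] = 0 \<Longrightarrow> lin F (faces xs) = lin F (aug_faces xs)"
  by (cases xs; cases "tl xs") (auto simp: faces_def)

definition bd :: "'a chain \<Rightarrow> 'a chain"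
  where "bd = lin faces"

lemma bd_simps [simp]:
  "bd 0 = 0" "bd (a + b) = bd a + bd b" "bd (gen xs) = faces xs"
  by (simp_all add: bd_def)

lemma bd_sum: "bd (sum c I) = (\<Sum>i\<in>I. bd (c i))"
  by (simp add: bd_def lin_sum)

lemma bd_lin: "bd (lin F c) = lin (\<lambda>x. bd (F x)) c"
  by (simp add: bd_def lin_lin)

definition push :: "('a \<Rightarrow> 'b) \<Rightarrow> 'a chain \<Rightarrow> 'b chain"
  where "push f = lin (\<lambda>xs. gen (map f xs))"

lemma push_simps [simp]:
  "push f 0 = 0" "push f (a + b) = push f a + push f b"
  "push f (gen xs) = gen (map f xs)"
  by (simp_all add: push_def)

lemma push_sum: "push f (sum c I) = (\<Sum>i\<in>I. push f (c i))"
  by (simp add: push_def lin_sum)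

lemma push_lin: "push f (lin F c) = lin (\<lambda>x. push f (F x)) c"
  by (simp add: push_def lin_lin)

lemma lin_push:
  fixes F :: "'b list \<Rightarrow> 'c::elementary_two_group"
  shows "lin F (push f c) = lin (\<lambda>xs. F (map f xs)) c"
  by (simp add: push_def lin_lin)

lemma push_push: "push f (push g c) = push (f \<circ> g) c"
  unfolding push_def[of f] lin_push by (simp add: push_def)

lemma push_cons_chain: "push f (cons_chain z c) = cons_chain (f z) (push f c)"
  by (simp add: push_def lin_cons_chain cons_chain_lin)

lemma push_aug_faces: "push f (aug_faces xs) = aug_faces (map f xs)"
  by (induction xs) (auto simp: push_cons_chain)

lemma push_faces: "push f (faces xs) = faces (map f xs)"
  by (simp add: faces_def push_aug_faces)

lemma push_bd: "push f (bd c) = bd (push f c)"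
  by (simp add: bd_def push_lin lin_push push_faces)

lemma keys_push: "Poly_Mapping.keys (push f c) \<subseteq> map f ` Poly_Mapping.keys c"
  unfolding push_def using keys_lin[of "\<lambda>xs. gen (map f xs)" c] by auto

text \<open>The Eilenberg--Zilber product of two simplices.\<close>

fun shuffle :: "'a list \<Rightarrow> 'b list \<Rightarrow> ('a \<times> 'b) chain" where
  "shuffle [] ys = 0"
| "shuffle (x # xs) [] = 0"
| "shuffle (x # xs) (y # ys) = cons_chain (x, y)
     ((if xs = [] \<and> ys = [] then gen [] else 0) + shuffle xs (y # ys) + shuffle (x # xs) ys)"

lemma shuffle_Nil_right [simp]: "shuffle xs [] = 0"
  by (cases xs) auto

lemma keys_shuffle:
  "zs \<in> Poly_Mapping.keys (shuffle xs ys) \<Longrightarrow>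
    zs \<noteq> [] \<and> set zs \<subseteq> set xs \<times> set ys \<and> Suc (length zs) = length xs + length ys"
proof (induction xs ys arbitrary: zs rule: shuffle.induct)
  case (3 x xs y ys)
  let ?e = "(if xs = [] \<and> ys = [] then gen [] else 0) :: ('a \<times> 'b) chain"
  obtain ws where ws: "zs = (x, y) # ws"
    "ws \<in> Poly_Mapping.keys (?e + shuffle xs (y # ys) + shuffle (x # xs) ys)"
    using subsetD[OF keys_cons_chain 3(3)[unfolded shuffle.simps]] by blast
  then consider "ws \<in> Poly_Mapping.keys ?e"
    | "ws \<in> Poly_Mapping.keys (shuffle xs (y # ys))" | "ws \<in> Poly_Mapping.keys (shuffle (x # xs) ys)"
    using subsetD[OF keys_add ws(2)] subsetD[OF keys_add, of ws ?e "shuffle xs (y # ys)"]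
    by (meson UnE)
  then show ?case
  proof cases
    case 1
    then show ?thesis using ws(1) by (simp split: if_splits)
  next
    case 2
    show ?thesis using 3(1)[OF 2] ws(1) by auto
  next
    case 3
    show ?thesis using "3.IH"(2)[OF 3] ws(1) by auto
  qed
qed auto

lemma push_if: "push f (if P then a else b) = (if P then push f a else push f b)"
  by simp

lemma shuffle_swap: "push prod.swap (shuffle xs ys) = shuffle ys xs"
proof (induction xs ys rule: shuffle.induct)
  case (3 x xs y ys)
  show ?case
    unfolding shuffle.simps push_cons_chain push_simps(2) 3 push_if by (simp add: ac_simps)
qed simp_all

lemma shuffle_map: "shuffle (map f xs) (map g ys) = push (map_prod f g) (shuffle xs ys)"
proof (induction xs ys rule: shuffle.induct)
  case (3 x xs y ys)
  then show ?case
    unfolding shuffle.simps push_cons_chain push_simps(2) push_if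
    by (simp del: shuffle.simps add: shuffle.simps(3)[of "f x" "map f xs" "g y" "map g ys"])
qed simp_all

lemma shuffle_vertex: "xs \<noteq> [] \<Longrightarrow> shuffle xs [v] = gen (map (\<lambda>x. (x, v)) xs)"
proof (induction xs)
  case (Cons x xs)
  then show ?case by (cases "xs = []") auto
qed auto

text \<open>The Leibniz rule in augmented form. The last term arises because the product of two
  vertices is a vertex, with augmented boundary \<open>gen []\<close>, whereas
  \<open>shuffle\<close> vanishes when one argument is empty.\<close>

lemma lin_aug_faces_shuffle:
  "lin aug_faces (shuffle xs ys) = lin (\<lambda>zs. shuffle zs ys) (aug_faces xs)
    + lin (shuffle xs) (aug_faces ys) + (if length xs = 1 \<and> length ys = 1 then gen [] else 0)"
proof (induction xs ys rule: shuffle.induct)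
  case (3 x xs y ys)
  \<comment> \<open>The boundary of a cone is its base plus the cone over the boundary of the
    base.\<close>
  have abd: "lin aug_faces (cons_chain z c) = c + cons_chain z (lin aug_faces c)"
    for z :: 'c and c
    by (simp add: lin_cons_chain lin_fun_add cons_chain_lin)
  have e1: "lin (\<lambda>zs. if zs = [] \<and> ys = [] then gen [] else 0) (aug_faces xs)
      = (if length xs = 1 \<and> ys = [] then gen [] else 0)"
    by (cases xs) (auto simp: lin_cons_chain)
  have e2: "lin (\<lambda>zs. if xs = [] \<and> zs = [] then gen [] else 0) (aug_faces ys)
      = (if xs = [] \<and> length ys = 1 then gen [] else 0)"
    by (cases ys) (auto simp: lin_cons_chain)
  have m1: "lin (\<lambda>zs. shuffle (x # zs) (y # ys)) (aug_faces xs) = cons_chain (x, y)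
      (lin (\<lambda>zs. if zs = [] \<and> ys = [] then gen [] else 0) (aug_faces xs)
       + lin (\<lambda>zs. shuffle zs (y # ys)) (aug_faces xs)
       + lin (\<lambda>zs. shuffle (x # zs) ys) (aug_faces xs))"
    unfolding lin_fun_add[symmetric] cons_chain_lin by simp
  have m2: "lin (\<lambda>zs. shuffle (x # xs) (y # zs)) (aug_faces ys) = cons_chain (x, y)
      (lin (\<lambda>zs. if xs = [] \<and> zs = [] then gen [] else 0) (aug_faces ys)
       + lin (\<lambda>zs. shuffle xs (y # zs)) (aug_faces ys)
       + lin (\<lambda>zs. shuffle (x # xs) zs) (aug_faces ys))"
    unfolding lin_fun_add[symmetric] cons_chain_lin by simp
  have m3: "lin aug_faces (shuffle (x # xs) (y # ys))
      = (if xs = [] \<and> ys = [] then gen [] else 0) + shuffle xs (y # ys) + shuffle (x # xs) ys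
        + cons_chain (x, y) (lin aug_faces (shuffle xs (y # ys)) + lin aug_faces (shuffle (x # xs) ys))"
    unfolding shuffle.simps abd by simp
  show ?case
    unfolding m3 3 aug_faces.simps lin_add lin_gen lin_cons_chain m1 m2 e1 e2
    by (cases "xs = []"; cases "ys = []") (simp_all add: ac_simps)
qed auto

lemma bd_shuffle:
  "bd (shuffle xs ys) = lin (\<lambda>zs. shuffle zs ys) (faces xs) + lin (shuffle xs) (faces ys)"
proof -
  note 1 = lin_faces[of "\<lambda>zs. shuffle zs ys" xs, simplified]
  note 2 = lin_faces[of "shuffle xs" ys, simplified]
  show ?thesis
  proof (cases "length xs \<le> 1 \<and> length ys \<le> 1")
    case True
    then have "bd (shuffle xs ys) = 0"
      by (cases xs; cases ys) (auto simp: faces_def)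
    then show ?thesis using True by (simp add: faces_def)
  next
    case False
    then have "bd (shuffle xs ys) = lin aug_faces (shuffle xs ys)"
      unfolding bd_def
    proof (intro lin_cong)
      fix zs assume zs: "zs \<in> Poly_Mapping.keys (shuffle xs ys)"
      then show "faces zs = aug_faces zs"
        using keys_shuffle[OF zs] False by (cases xs; cases ys) (auto simp: faces_def)
    qed
    then show ?thesis using False by (auto simp: lin_aug_faces_shuffle 1 2)
  qed
qed

definition cross :: "'a chain \<Rightarrow> 'b chain \<Rightarrow> ('a \<times> 'b) chain"
  where "cross a b = lin (\<lambda>xs. lin (shuffle xs) b) a"

lemma cross_add [simp]:
  "cross (a + a') b = cross a b + cross a' b" "cross a (b + b') = cross a b + cross a b'"
  "cross 0 b = 0" "cross a 0 = 0"
  by (simp_all add: cross_def lin_fun_add)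

lemma bd_cross: "bd (cross a b) = cross (bd a) b + cross a (bd b)"
proof -
  have "bd (cross a b) = lin (\<lambda>xs. lin (\<lambda>ys. lin (\<lambda>zs. shuffle zs ys) (faces xs)) b) a
      + lin (\<lambda>xs. lin (\<lambda>ys. lin (shuffle xs) (faces ys)) b) a"
    unfolding cross_def bd_lin bd_shuffle lin_fun_add ..
  also have "lin (\<lambda>xs. lin (\<lambda>ys. lin (shuffle xs) (faces ys)) b) a = cross a (bd b)"
    by (simp add: cross_def bd_def lin_lin)
  also have "lin (\<lambda>xs. lin (\<lambda>ys. lin (\<lambda>zs. shuffle zs ys) (faces xs)) b) a = cross (bd a) b"
    unfolding cross_def bd_def lin_lin by (intro lin_cong, rule lin_swap)
  finally show ?thesis .
qed

text \<open>Modulo 2, exchanging the factors introduces no sign. This is used at the far end of the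
  rotation path, where the two blocks have changed places.\<close>

lemma cross_swap: "push prod.swap (cross a b) = cross b a"
  unfolding cross_def push_lin shuffle_swap by (rule lin_swap)

lemma cross_push: "cross (push f a) (push g b) = push (map_prod f g) (cross a b)"
  unfolding cross_def lin_push push_lin shuffle_map ..

text \<open>The empty simplex is excluded because \<open>shuffle [] [v]\<close> is 0, while
  \<open>push\<close> keeps the empty simplex.\<close>

lemma cross_vertex:
  assumes "[] \<notin> Poly_Mapping.keys a"
  shows "cross a (gen [v]) = push (\<lambda>x. (x, v)) a"
  unfolding cross_def push_def
proof (intro lin_cong)
  fix xs assume "xs \<in> Poly_Mapping.keys a"
  then have "xs \<noteq> []" using assms by blast
  then show "lin (shuffle xs) (gen [v]) = gen (map (\<lambda>x. (x, v)) xs)"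
    by (simp add: shuffle_vertex)
qed

lemma keys_cross:
  assumes "zs \<in> Poly_Mapping.keys (cross a b)"
  obtains xs ys where "xs \<in> Poly_Mapping.keys a" "ys \<in> Poly_Mapping.keys b"
    "zs \<noteq> []" "set zs \<subseteq> set xs \<times> set ys" "Suc (length zs) = length xs + length ys"
proof -
  obtain xs where xs: "xs \<in> Poly_Mapping.keys a" "zs \<in> Poly_Mapping.keys (lin (shuffle xs) b)"
    using subsetD[OF keys_lin assms[unfolded cross_def]] by blast
  obtain ys where "ys \<in> Poly_Mapping.keys b" "zs \<in> Poly_Mapping.keys (shuffle xs ys)"
    using subsetD[OF keys_lin xs(2)] by blast
  then show thesis using that[of xs ys] xs(1) keys_shuffle[of zs xs ys] by simp
qed

text \<open>The segment from 0 to \<open>n\<close>, subdivided at the integers, which will number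
  the sample points of a path.\<close>

definition interval_chain :: "nat \<Rightarrow> nat chain"
  where "interval_chain n = (\<Sum>i<n. gen [i, Suc i])"

lemma bd_interval_chain: "bd (interval_chain n) = gen [0] + gen [n]"
proof (induction n)
  case (Suc n)
  have "interval_chain (Suc n) = interval_chain n + gen [n, Suc n]"
    by (simp add: interval_chain_def)
  then show ?case using Suc by (simp add: faces_def add.assoc)
qed (simp add: interval_chain_def)

lemma keys_interval_chain: "is \<in> Poly_Mapping.keys (interval_chain n) \<Longrightarrow> \<exists>i<n. is = [i, Suc i]"
  unfolding interval_chain_def using keys_sum[of "\<lambda>i. gen [i, Suc i]" "{..<n}"] by auto

section \<open>Antipodal chains\<close>

lemma push_id [simp]: "push id c = c" "push (\<lambda>x. x) c = c"
  by (simp_all add: push_def)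

text \<open>Only \<open>c 0\<close> to \<open>c (N - 1)\<close> are constrained. They act as the
  hemispheres in the antipodal cell structure of a sphere, and \<open>S\<close> controls the size of
  a simplex through its vertex set.\<close>

definition antipodal_chains :: "('a \<Rightarrow> 'a) \<Rightarrow> ('a set \<Rightarrow> bool) \<Rightarrow> nat \<Rightarrow> (nat \<Rightarrow> 'a chain) \<Rightarrow> bool"
  where "antipodal_chains \<tau> S N c \<longleftrightarrow> (\<exists>v. c 0 = gen [v]) \<and>
    (\<forall>j<N. \<forall>xs\<in>Poly_Mapping.keys (c j). length xs = Suc j \<and> S (set xs)) \<and>
    (\<forall>j. Suc j < N \<longrightarrow> bd (c (Suc j)) = c j + push \<tau> (c j))"

section \<open>Alternating labels and Fan's lemma\<close>

fun alt :: "bool \<Rightarrow> nat list \<Rightarrow> bit" where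
  "alt s [] = 1"
| "alt s (x # xs) = (if even x = s then alt (\<not> s) xs else 0)"

text \<open>\<open>alt s\<close> detects the lists of alternating parity whose first entry is even
  exactly when \<open>s\<close> holds. An alternating list stays alternating only if an end is
  dropped, and dropping the first entry reverses the initial sign. In a list with a single
  repetition of sign, the deletions of the two equal neighbours cancel.\<close>

lemma alt_faces: "lin (alt s) (aug_faces xs) = alt s xs + alt (\<not> s) xs"
proof (induction xs arbitrary: s)
  case (Cons x xs)
  show ?case
    by (cases "even x = s") (auto simp: lin_cons_chain Cons ac_simps)
qed simp

text \<open>The right-hand side does not depend on the order of the vertices, which allows
  \<open>alt_sort_faces\<close> to pass to the sorted list, whose faces are sorted as well.\<close>

lemma lin_aug_faces_mset:
  fixes h :: "'a multiset \<Rightarrow> 'b::elementary_two_group"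
  shows "lin (\<lambda>l. h (mset l)) (aug_faces xs) = (\<Sum>x\<in>#mset xs. h (mset xs - {#x#}))"
proof (induction xs arbitrary: h)
  case (Cons x xs)
  have "(\<Sum>y\<in>#mset xs. h (add_mset x (mset xs - {#y#})))
      = (\<Sum>y\<in>#mset xs. h (add_mset x (mset xs) - {#y#}))"
    by (intro arg_cong[where f = sum_mset] image_mset_cong) (auto simp: insert_DiffM2)
  then show ?case
    by (simp add: lin_cons_chain Cons[of "\<lambda>m. h (add_mset x m)"])
qed simp

lemma sorted_aug_faces:
  "sorted xs \<Longrightarrow> l \<in> Poly_Mapping.keys (aug_faces xs) \<Longrightarrow> sorted l \<and> set l \<subseteq> set xs"
proof (induction xs arbitrary: l)
  case (Cons x xs)
  then consider "l = xs" | l' where "l = x # l'" "l' \<in> Poly_Mapping.keys (aug_faces xs)"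
    using subsetD[OF keys_add, of l "gen xs" "cons_chain x (aug_faces xs)"]
      subsetD[OF keys_cons_chain, of l x "aug_faces xs"] by fastforce
  then show ?case
    by cases (use Cons in fastforce)+
qed simp

lemma alt_sort_faces:
  "lin (\<lambda>l. alt s (sort l)) (aug_faces xs) = alt s (sort xs) + alt (\<not> s) (sort xs)"
proof -
  have *: "lin (\<lambda>l. alt s (sort l)) (aug_faces ys)
      = (\<Sum>x\<in>#mset ys. alt s (sorted_list_of_multiset (mset ys - {#x#})))" for ys
    using lin_aug_faces_mset[of "\<lambda>m. alt s (sorted_list_of_multiset m)" ys]
    by simp
  have "lin (\<lambda>l. alt s (sort l)) (aug_faces xs) = lin (\<lambda>l. alt s (sort l)) (aug_faces (sort xs))"
    unfolding * mset_sort ..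
  also have "\<dots> = lin (alt s) (aug_faces (sort xs))"
    by (intro lin_cong arg_cong[where f = "alt s"] sorted_sort_id)
      (rule sorted_aug_faces[OF sorted_sort, THEN conjunct1])
  finally show ?thesis by (simp add: alt_faces)
qed

text \<open>The labels \<open>2 * i\<close> and \<open>2 * i + 1\<close> play the role of \<open>+i\<close> and \<open>-i\<close>.\<close>

definition flip :: "nat \<Rightarrow> nat"
  where "flip x = (if even x then x + 1 else x - 1)"

lemma alt_flip: "alt s (map flip xs) = alt (\<not> s) xs"
  by (induction xs arbitrary: s) (auto simp: flip_def)

text \<open>Two distinct labels with the same absolute value \<open>x div 2\<close> are
  complementary.\<close>

lemma div_2_less_if_not_flip: "x < y \<Longrightarrow> y \<noteq> flip x \<Longrightarrow> x div 2 < y div 2"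
  by (auto simp: flip_def split: if_splits elim!: evenE oddE)

lemma flip_mono: "x \<le> y \<Longrightarrow> y \<noteq> flip x \<Longrightarrow> flip x \<le> flip y"
  using div_2_less_if_not_flip[of x y] by (auto simp: flip_def elim!: evenE oddE)

text \<open>Without complementary pairs, distinct labels are ordered by their absolute values, so
  \<open>flip\<close> is monotone on them.\<close>

lemma sort_map_flip:
  assumes "\<And>x y. x \<in> set xs \<Longrightarrow> y \<in> set xs \<Longrightarrow> y \<noteq> flip x"
  shows "sort (map flip xs) = map flip (sort xs)"
proof (rule properties_for_sort)
  show "sorted (map flip (sort xs))"
    unfolding sorted_map
    by (rule sorted_wrt_mono_rel[of "sort xs" "(\<le>)"]) (auto intro!: flip_mono dest: assms)
qed simp

text \<open>Neighbours have opposite signs and are not complementary, so the absolute values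
  increase strictly. They start at \<open>hd xs div 2\<close> and stay below
  \<open>k\<close>.\<close>

lemma alt_length:
  assumes "sorted xs" "\<And>x y. x \<in> set xs \<Longrightarrow> y \<in> set xs \<Longrightarrow> y \<noteq> flip x"
    and "\<And>x. x \<in> set xs \<Longrightarrow> x < 2 * k" "alt s xs \<noteq> 0" "xs \<noteq> []"
  shows "length xs + hd xs div 2 \<le> k"
  using assms
proof (induction xs arbitrary: s)
  case (Cons x xs)
  show ?case
  proof (cases xs)
    case Nil
    then show ?thesis using Cons.prems(3)[of x] by simp
  next
    case (Cons y ys)
    have 1: "length xs + hd xs div 2 \<le> k"
      using Cons.prems Cons by (intro Cons.IH[of "\<not> s"]) (auto split: if_splits)
    have "x \<noteq> y" using Cons.prems(4) Cons by (auto split: if_splits)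
    then have "x < y" using Cons.prems(1) Cons by auto
    then have "x div 2 < y div 2"
      using Cons.prems(2)[of x y] Cons by (intro div_2_less_if_not_flip) auto
    then show ?thesis using 1 Cons by simp
  qed
qed simp

text \<open>Fan's combinatorial lemma, for chains instead of triangulated spheres: the parity of the
  number of alternating simplices of \<open>c j\<close> does not depend on \<open>j\<close>.\<close>

lemma antipodal_chains_labelling:
  assumes c: "antipodal_chains \<tau> S (Suc k) c"
    and lt: "\<And>X x. S X \<Longrightarrow> x \<in> X \<Longrightarrow> label x < 2 * k"
    and anti: "\<And>X x. S X \<Longrightarrow> x \<in> X \<Longrightarrow> label (\<tau> x) = flip (label x)"
    and nc: "\<And>X x y. S X \<Longrightarrow> x \<in> X \<Longrightarrow> y \<in> X \<Longrightarrow> label y \<noteq> flip (label x)"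
  shows False
proof -
  define \<phi> where "\<phi> s xs = alt s (sort (map label xs))" for s xs
  have keys: "length xs = Suc j" "S (set xs)" if "xs \<in> Poly_Mapping.keys (c j)" "j \<le> k" for xs j
    using c that le_imp_less_Suc unfolding antipodal_chains_def by blast+
  have \<phi>\<tau>: "\<phi> True (map \<tau> xs) = \<phi> False xs" if "xs \<in> Poly_Mapping.keys (c j)" "j \<le> k" for xs j
  proof -
    have "map label (map \<tau> xs) = map flip (map label xs)"
      using anti[OF keys(2)[OF that]] by simp
    moreover have "sort (map flip (map label xs)) = map flip (sort (map label xs))"
      using nc[OF keys(2)[OF that]] by (intro sort_map_flip) auto
    ultimately show ?thesis unfolding \<phi>_def by (metis alt_flip)
  qed
  have \<phi>bd: "lin (\<phi> True) (faces xs) = \<phi> True xs + \<phi> False xs"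
    if "length xs > 1" for xs
  proof -
    have "lin (\<phi> True) (faces xs) = lin (\<lambda>l. alt True (sort l)) (push label (faces xs))"
      unfolding lin_push \<phi>_def ..
    then show ?thesis using that by (simp add: push_faces push_aug_faces faces_def alt_sort_faces \<phi>_def)
  qed
  \<comment> \<open>The count on \<open>c (Suc j)\<close> equals the \<open>True\<close> count on
    its boundary \<open>c j + push \<tau> (c j)\<close>, and \<open>\<tau>\<close> turns the
    \<open>True\<close> count into the \<open>False\<close> count.\<close>
  have const: "lin (\<lambda>xs. \<phi> True xs + \<phi> False xs) (c j) = 1" if "j \<le> k" for j
    using that
  proof (induction j)
    case 0
    obtain v where "c 0 = gen [v]" using c unfolding antipodal_chains_def by blast
    then show ?case by (simp add: \<phi>_def)
  next
    case (Suc j)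
    have "lin (\<lambda>xs. \<phi> True xs + \<phi> False xs) (c (Suc j)) = lin (\<lambda>xs. lin (\<phi> True) (faces xs)) (c (Suc j))"
      using keys(1)[OF _ Suc.prems] by (intro lin_cong) (simp add: \<phi>bd)
    also have "\<dots> = lin (\<phi> True) (bd (c (Suc j)))"
      by (simp add: bd_def lin_lin)
    also have "bd (c (Suc j)) = c j + push \<tau> (c j)"
      using c Suc.prems unfolding antipodal_chains_def by simp
    also have "lin (\<phi> True) (c j + push \<tau> (c j)) = lin (\<phi> True) (c j) + lin (\<lambda>xs. \<phi> True (map \<tau> xs)) (c j)"
      by (simp add: lin_push)
    also have "lin (\<lambda>xs. \<phi> True (map \<tau> xs)) (c j) = lin (\<phi> False) (c j)"
      using \<phi>\<tau> Suc.prems by (intro lin_cong) simp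
    finally show ?case using Suc.IH[OF Suc_leD[OF Suc.prems]] unfolding lin_fun_add by (rule trans)
  qed
  \<comment> \<open>A simplex of \<open>c k\<close> has \<open>k + 1\<close> vertices, too many for
    strictly increasing absolute values below \<open>k\<close>.\<close>
  have "\<phi> s xs = 0" if "xs \<in> Poly_Mapping.keys (c k)" for s xs
  proof (rule ccontr)
    assume "\<phi> s xs \<noteq> 0"
    moreover have "sort (map label xs) \<noteq> []"
      using keys(1)[OF that] by (auto simp flip: length_0_conv)
    ultimately have "length (sort (map label xs)) + hd (sort (map label xs)) div 2 \<le> k"
      using keys(2)[OF that] lt nc unfolding \<phi>_def
      by (intro alt_length) auto
    then show False using keys(1)[OF that] by simp
  qed
  then have "lin (\<lambda>xs. \<phi> True xs + \<phi> False xs) (c k) = lin (\<lambda>xs. 0) (c k)"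
    by (intro lin_cong) simp
  then show False using const[of k] by simp
qed

text \<open>\<open>\<Phi> i a b\<close> stands for sample points of the rotation path from the block
  sum of \<open>a\<close> and \<open>b\<close> at \<open>i = 0\<close> to that of \<open>b\<close>
  and \<open>a\<close> at \<open>i = n\<close>. It intertwines the involutions, and
  \<open>S'\<close> is required for vertex sets that use two neighbouring parameters.\<close>

lemma antipodal_chains_double:
  fixes \<Phi> :: "nat \<Rightarrow> 'a \<Rightarrow> 'a \<Rightarrow> 'b"
  assumes c: "antipodal_chains \<tau> S N c" and N: "even N" "N > 0" and n: "n > 0"
    and \<tau>\<tau>: "\<And>x. \<tau> (\<tau> x) = x"
    and \<Phi>_end: "\<And>a b. \<Phi> n a b = \<Phi> 0 b a"
    and \<Phi>_\<tau>: "\<And>i a b. \<Phi> i (\<tau> a) (\<tau> b) = \<tau>' (\<Phi> i a b)"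
    and S\<tau>: "\<And>X. S X \<Longrightarrow> S (\<tau> ` X)"
    and S': "\<And>X Y Z i. S X \<Longrightarrow> S Y \<Longrightarrow> i < n \<Longrightarrow>
      Z \<subseteq> {\<Phi> i' a b | i' a b. i' \<in> {i, Suc i} \<and> a \<in> X \<and> b \<in> Y} \<Longrightarrow> S' Z"
  shows "\<exists>d. antipodal_chains \<tau>' S' (2 * N) d"
proof -
  \<comment> \<open>After extension by zero the boundary relation fails only at index
    \<open>N\<close>, where the defect is the cycle \<open>z\<close>.\<close>
  define C where "C j = (if j < N then c j else 0)" for j
  define z where "z = C (N - 1) + push \<tau> (C (N - 1))"
  define P where "P i = push (\<tau> ^^ i)" for i
  define D where "D j = (\<Sum>i\<le>j. cross (C i) (P i (C (j - i))))" for j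
  define F0 where "F0 = (\<lambda>(a, b). \<Phi> 0 a b)"
  define G where "G = (\<lambda>((a, b), i). \<Phi> i a b)"
  define H where "H w = push G (cross w (interval_chain n))" for w
  \<comment> \<open>For \<open>N \<le> j\<close> the prism over \<open>cross z (C (j - N))\<close>,
    of dimension \<open>(N - 1) + (j - N) + 1 = j\<close>, cancels the error in the boundary of
    \<open>D j\<close>.\<close>
  define d where "d j = push F0 (D j) + (if N \<le> j then H (cross z (C (j - N))) else 0)" for j
  let ?T = "map_prod \<tau> \<tau>"
  have \<tau>_id: "\<tau> \<circ> \<tau> = id" using \<tau>\<tau> by (simp add: fun_eq_iff)
  have push\<tau>\<tau>: "push \<tau> (push \<tau> a) = a" for a
    unfolding push_push \<tau>_id by simp
  have \<tau>z: "push \<tau> z = z"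
    unfolding z_def by (simp add: push\<tau>\<tau> add.commute)
  have P_Suc: "P (Suc i) a = P i (push \<tau> a)" "P (Suc i) a = push \<tau> (P i a)" for i a
    unfolding P_def push_push by (simp_all add: funpow_Suc_right flip: funpow.simps(2))
  have P_add: "P i (a + b) = P i a + P i b" "P i 0 = 0" for i a b
    by (simp_all add: P_def)
  have Pz: "P i z = z" for i
    by (induction i) (simp_all add: P_Suc(1) \<tau>z, simp add: P_def)
  \<comment> \<open>Evenness of \<open>N\<close> makes \<open>P N\<close> the identity, so the error
    terms carry no power of \<open>\<tau>\<close>.\<close>
  have PN: "P N a = a" for a
  proof -
    have "P (2 * i) a = a" for i
      by (induction i) (simp_all add: P_Suc(1) push\<tau>\<tau>, simp add: P_def)
    then show ?thesis using N(1) by (metis evenE)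
  qed
  obtain v where v: "c 0 = gen [v]" using c unfolding antipodal_chains_def by blast
  have keysC: "length xs = Suc j" "S (set xs)" "j < N" if "xs \<in> Poly_Mapping.keys (C j)" for xs j
    using c that unfolding antipodal_chains_def C_def by (auto split: if_splits)
  have bdC0: "bd (C 0) = 0" using v N by (simp add: C_def faces_def)
  have bdC: "bd (C (Suc j)) = C j + push \<tau> (C j) + (if Suc j = N then z else 0)" for j
    using c unfolding antipodal_chains_def z_def C_def by auto
  \<comment> \<open>The boundary of \<open>C (N - 1)\<close> is invariant under
    \<open>\<tau>\<close>, so it cancels against the boundary of the image.\<close>
  have bdz: "bd z = 0"
  proof -
    have "N \<ge> 2" using N by (cases "N = 1") auto
    then obtain r where "N = Suc (Suc r)" using le_Suc_ex[of 2 N] by auto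
    then show ?thesis
      using bdC[of r] unfolding z_def by (simp add: push_bd[symmetric] push\<tau>\<tau> ac_simps)
  qed
  have crossT: "push ?T (cross a b) = cross (push \<tau> a) (push \<tau> b)" for a b
    by (simp add: cross_push)
  have bdD: "bd (D (Suc j)) = D j + push ?T (D j)
      + (if N \<le> Suc j then cross z (C (Suc j - N)) + cross (C (Suc j - N)) z else 0)" for j
  proof -
    have "bd (D (Suc j)) = (\<Sum>i\<le>Suc j. cross (bd (C i)) (P i (C (Suc j - i))))
        + (\<Sum>i\<le>Suc j. cross (C i) (P i (bd (C (Suc j - i)))))"
      unfolding D_def bd_sum bd_cross sum.distrib P_def push_bd ..
    also have "(\<Sum>i\<le>Suc j. cross (bd (C i)) (P i (C (Suc j - i))))
        = (\<Sum>i\<le>j. cross (bd (C (Suc i))) (P (Suc i) (C (j - i))))"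
      by (subst sum.atMost_Suc_shift) (simp add: bdC0)
    also have "\<dots> = (\<Sum>i\<le>j. cross (C i) (P (Suc i) (C (j - i))) + cross (push \<tau> (C i)) (P (Suc i) (C (j - i))))
        + (\<Sum>i\<le>j. if Suc i = N then cross z (P N (C (j - i))) else 0)"
      unfolding bdC sum.distrib[symmetric] by (intro sum.cong) auto
    also have "(\<Sum>i\<le>j. if Suc i = N then cross z (P N (C (j - i))) else 0)
        = (\<Sum>i\<le>j. if i = N - 1 then cross z (C (Suc j - N)) else 0)"
      unfolding PN using N(2) by (intro sum.cong) auto
    also have "\<dots> = (if N \<le> Suc j then cross z (C (Suc j - N)) else 0)"
      using N(2) by (subst sum.delta) auto
    also have "(\<Sum>i\<le>Suc j. cross (C i) (P i (bd (C (Suc j - i)))))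
        = (\<Sum>i\<le>j. cross (C i) (P i (bd (C (Suc (j - i))))))"
      by (simp add: bdC0 P_add Suc_diff_le)
    also have "\<dots> = (\<Sum>i\<le>j. cross (C i) (P i (C (j - i))) + cross (C i) (P (Suc i) (C (j - i))))
        + (\<Sum>i\<le>j. if Suc (j - i) = N then cross (C i) z else 0)"
      unfolding bdC sum.distrib[symmetric] by (intro sum.cong) (auto simp: P_add P_Suc(1) Pz)
    also have "(\<Sum>i\<le>j. if Suc (j - i) = N then cross (C i) z else 0)
        = (\<Sum>i\<le>j. if i = Suc j - N then (if N \<le> Suc j then cross (C (Suc j - N)) z else 0) else 0)"
      using N(2) by (intro sum.cong) auto
    also have "\<dots> = (if N \<le> Suc j then cross (C (Suc j - N)) z else 0)"
      using N(2) by (subst sum.delta) auto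
    \<comment> \<open>The first sum on the right also occurs in the other half of the boundary and
      cancels modulo 2. The twist \<open>P i\<close> in the second factor serves this
      purpose.\<close>
    also have "(\<Sum>i\<le>j. cross (C i) (P (Suc i) (C (j - i))) + cross (push \<tau> (C i)) (P (Suc i) (C (j - i))))
        = (\<Sum>i\<le>j. cross (C i) (P (Suc i) (C (j - i)))) + push ?T (D j)"
      by (simp add: D_def push_sum crossT P_Suc(2) sum.distrib)
    finally show ?thesis
      by (simp add: sum.distrib ac_simps flip: D_def)
  qed
  have F0T: "push F0 (push ?T w) = push \<tau>' (push F0 w)" for w
    unfolding push_push by (rule arg_cong[where f = "\<lambda>f. push f w"]) (auto simp: F0_def \<Phi>_\<tau>)
  have HT: "H (push ?T w) = push \<tau>' (H w)" for w
  proof -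
    have "H (push ?T w) = push G (cross (push ?T w) (push id (interval_chain n)))"
      by (simp add: H_def)
    also have "\<dots> = push \<tau>' (H w)"
      unfolding cross_push push_push H_def
      by (rule arg_cong[where f = "\<lambda>f. push f _"]) (auto simp: G_def \<Phi>_\<tau>)
    finally show ?thesis .
  qed
  have H_add: "H (a + b) = H a + H b" "H 0 = 0" for a b
    by (simp_all add: H_def)
  \<comment> \<open>The boundary of a prism consists of the side and the two ends. By
    \<open>\<Phi>_end\<close> the far end is the near end with the factors exchanged.\<close>
  have bdH: "bd (H (cross a b)) = H (bd (cross a b)) + push F0 (cross a b) + push F0 (cross b a)" for a b
  proof -
    let ?w = "cross a b"
    have ne: "[] \<notin> Poly_Mapping.keys ?w" by (blast elim: keys_cross)
    have "bd (H ?w) = push G (cross (bd ?w) (interval_chain n)) + push G (cross ?w (gen [0])) + push G (cross ?w (gen [n]))"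
      unfolding H_def push_bd[symmetric] bd_cross[of ?w] bd_interval_chain by (simp add: ac_simps)
    also have "push G (cross ?w (gen [0])) = push F0 ?w"
      unfolding cross_vertex[OF ne] push_push
      by (rule arg_cong[where f = "\<lambda>f. push f _"]) (auto simp: G_def F0_def)
    also have "push G (cross ?w (gen [n])) = push F0 (push prod.swap ?w)"
      unfolding cross_vertex[OF ne] push_push
      by (rule arg_cong[where f = "\<lambda>f. push f _"]) (auto simp: G_def F0_def \<Phi>_end)
    finally show ?thesis by (simp add: cross_swap H_def)
  qed
  have bdd: "bd (d (Suc j)) = d j + push \<tau>' (d j)" if "Suc j < 2 * N" for j
  proof -
    have "push F0 (bd (D (Suc j))) = push F0 (D j) + push \<tau>' (push F0 (D j))
        + (if N \<le> Suc j then push F0 (cross z (C (Suc j - N))) + push F0 (cross (C (Suc j - N)) z) else 0)"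
      by (simp add: bdD F0T)
    moreover have "bd (H (cross z (C (Suc j - N)))) = (if N \<le> j then H (cross z (C (j - N))) + push \<tau>' (H (cross z (C (j - N)))) else 0)
        + push F0 (cross z (C (Suc j - N))) + push F0 (cross (C (Suc j - N)) z)" if "N \<le> Suc j"
    proof (cases "N \<le> j")
      case True
      \<comment> \<open>This limits the construction to \<open>2 * N\<close> chains: at equality,
        \<open>bdC\<close> would contribute a further copy of \<open>z\<close>.\<close>
      moreover have "Suc (j - N) \<noteq> N" using True \<open>Suc j < 2 * N\<close> by linarith
      ultimately have "bd (cross z (C (Suc j - N))) = cross z (C (j - N)) + push ?T (cross z (C (j - N)))"
        by (simp add: bd_cross bdz bdC crossT \<tau>z Suc_diff_le)
      then show ?thesis using True by (simp add: bdH H_add HT ac_simps)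
    next
      case False
      then have "Suc j = N" using that by simp
      then show ?thesis using False by (simp add: bdH bd_cross bdz bdC0 H_add)
    qed
    ultimately show ?thesis
      unfolding d_def bd_simps push_bd[symmetric] by (auto simp: push_bd ac_simps)
  qed
  have SP: "S (set ys)" "length ys = Suc j" if "ys \<in> Poly_Mapping.keys (P i (C j))" for ys i j
    using that
  proof (induction i arbitrary: ys)
    case 0
    { case 1 then show ?case using keysC by (simp add: P_def)
    next
      case 2 then show ?case using keysC by (simp add: P_def) }
  next
    case (Suc i)
    { case 1
      then obtain xs where "ys = map \<tau> xs" "xs \<in> Poly_Mapping.keys (P i (C j))"
        using keys_push unfolding P_Suc(2) by blast
      then show ?case using Suc S\<tau> by auto
    next
      case 2
      then obtain xs where "ys = map \<tau> xs" "xs \<in> Poly_Mapping.keys (P i (C j))"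
        using keys_push unfolding P_Suc(2) by blast
      then show ?case using Suc by auto }
  qed
  have keysz: "length xs = N \<and> S (set xs)" if xs: "xs \<in> Poly_Mapping.keys z" for xs
  proof -
    have "xs \<in> Poly_Mapping.keys (C (N - 1)) \<or> xs \<in> Poly_Mapping.keys (P 1 (C (N - 1)))"
      using subsetD[OF keys_add xs[unfolded z_def]] by (simp add: P_def)
    then show ?thesis using SP[of xs 1 "N - 1"] keysC[of xs "N - 1"] N by auto
  qed
  have keysd: "length zs = Suc j \<and> S' (set zs)" if zs: "zs \<in> Poly_Mapping.keys (d j)" for zs j
  proof -
    consider "zs \<in> Poly_Mapping.keys (push F0 (D j))"
      | "N \<le> j" "zs \<in> Poly_Mapping.keys (H (cross z (C (j - N))))"
      using subsetD[OF keys_add zs[unfolded d_def]] by (auto split: if_splits)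
    then show ?thesis
    proof cases
      case 1
      then obtain ws where ws: "zs = map F0 ws" "ws \<in> Poly_Mapping.keys (D j)"
        using keys_push by blast
      then obtain i where i: "i \<le> j" "ws \<in> Poly_Mapping.keys (cross (C i) (P i (C (j - i))))"
        using subsetD[OF keys_sum ws(2)[unfolded D_def]] by auto
      obtain xs ys where xy: "xs \<in> Poly_Mapping.keys (C i)" "ys \<in> Poly_Mapping.keys (P i (C (j - i)))"
        "set ws \<subseteq> set xs \<times> set ys" "Suc (length ws) = length xs + length ys"
        using keys_cross[OF i(2)] by metis
      have "S' (set zs)"
        using xy(3) n
        by (intro S'[of "set xs" "set ys" 0] keysC(2)[OF xy(1)] SP(1)[OF xy(2)]) (auto simp: ws F0_def)
      then show ?thesis
        using xy(4) keysC(1)[OF xy(1)] SP(2)[OF xy(2)] i(1) ws(1) by simp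
    next
      case 2
      then obtain ws where ws: "zs = map G ws" "ws \<in> Poly_Mapping.keys (cross (cross z (C (j - N))) (interval_chain n))"
        using keys_push unfolding H_def by blast
      obtain us ks where ui: "us \<in> Poly_Mapping.keys (cross z (C (j - N)))" "ks \<in> Poly_Mapping.keys (interval_chain n)"
        "set ws \<subseteq> set us \<times> set ks" "Suc (length ws) = length us + length ks"
        using keys_cross[OF ws(2)] by metis
      obtain i where i: "i < n" "ks = [i, Suc i]" using keys_interval_chain[OF ui(2)] by blast
      obtain xs ys where xy: "xs \<in> Poly_Mapping.keys z" "ys \<in> Poly_Mapping.keys (C (j - N))"
        "set us \<subseteq> set xs \<times> set ys" "Suc (length us) = length xs + length ys"
        using keys_cross[OF ui(1)] by metis
      have "set ws \<subseteq> (set xs \<times> set ys) \<times> {i, Suc i}" using ui(3) xy(3) i(2) by auto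
      then have "set zs \<subseteq> {\<Phi> i' a b | i' a b. i' \<in> {i, Suc i} \<and> a \<in> set xs \<and> b \<in> set ys}"
        unfolding ws(1) G_def by fastforce
      then have "S' (set zs)"
        using keysz[OF xy(1)] keysC(2)[OF xy(2)] i(1) by (intro S'[of "set xs" "set ys" i]) auto
      then show ?thesis
        using ui(4) xy(4) keysz[OF xy(1)] keysC(1)[OF xy(2)] i(2) ws(1) 2(1) by simp
    qed
  qed
  have "d 0 = gen [\<Phi> 0 v v]"
    using N v unfolding d_def D_def C_def P_def F0_def by (simp add: cross_def)
  then have "antipodal_chains \<tau>' S' (2 * N) d"
    unfolding antipodal_chains_def using bdd keysd by blast
  then show ?thesis by (intro exI[of _ d])
qed

section \<open>Doubling of involutive matrices\<close>

text \<open>The size is a parameter rather than part of the type, because the induction doubles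
  it.\<close>

definition involutive_matrix :: "nat \<Rightarrow> (nat \<Rightarrow> nat \<Rightarrow> real) \<Rightarrow> bool"
  where "involutive_matrix N A \<longleftrightarrow>
    (\<forall>i<N. \<forall>j<N. A i j = A j i \<and> (\<Sum>k<N. A i k * A k j) = of_bool (i = j))"

text \<open>The entries of \<open>Q = (I + R) / 2\<close>, the orthogonal projection onto the line
  of angle \<open>t/2\<close>, with \<open>True\<close> for the first coordinate.\<close>

definition twist_coeff :: "real \<Rightarrow> bool \<Rightarrow> bool \<Rightarrow> real"
  where "twist_coeff t p q =
    (if p = q then if p then (1 + cos t) / 2 else (1 - cos t) / 2 else sin t / 2)"

text \<open>The block matrix of \<open>(A + B)/2 \<otimes> I + (A - B)/2 \<otimes> R\<close>, with \<open>R\<close> the reflection of the plane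
  in the line of angle \<open>t/2\<close>.\<close>

definition twist :: "real \<Rightarrow> (nat \<Rightarrow> nat \<Rightarrow> real) \<Rightarrow> (nat \<Rightarrow> nat \<Rightarrow> real) \<Rightarrow> nat \<Rightarrow> nat \<Rightarrow> real"
  where "twist t A B i j = twist_coeff t (even i) (even j) * A (i div 2) (j div 2)
    + (if even i = even j then twist_coeff t (odd i) (odd j) else - twist_coeff t (even i) (even j))
      * B (i div 2) (j div 2)"

lemma sum_lessThan_double: "(\<Sum>k<2 * N::nat. f k) = (\<Sum>k<N. f (2 * k) + f (2 * k + 1) :: 'a::comm_monoid_add)"
  by (induction N) (simp_all add: ac_simps)

lemma sum_bilinear:
  fixes A B :: "nat \<Rightarrow> nat \<Rightarrow> real"
  shows "(\<Sum>k<N. (p * A i k + q * B i k) * (r * A k j + s * B k j))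
    = p * r * (\<Sum>k<N. A i k * A k j) + p * s * (\<Sum>k<N. A i k * B k j)
    + q * r * (\<Sum>k<N. B i k * A k j) + q * s * (\<Sum>k<N. B i k * B k j)"
  unfolding sum_distrib_left sum.distrib[symmetric] by (simp add: algebra_simps)

text \<open>With the projection \<open>Q\<close> onto the line, the twist is \<open>A\<close> tensor
  \<open>Q\<close> plus \<open>B\<close> tensor \<open>I - Q\<close>. In the square the mixed
  products vanish because \<open>Q (I - Q) = 0\<close>, and the other two add up to the
  identity.\<close>

lemma involutive_matrix_twist:
  assumes A: "involutive_matrix N A" and B: "involutive_matrix N B"
  shows "involutive_matrix (2 * N) (twist t A B)"
  unfolding involutive_matrix_def
proof (intro allI impI conjI)
  fix i j assume ij: "i < 2 * N" "j < 2 * N"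
  define i' j' where "i' = i div 2" and "j' = j div 2"
  have ij': "i' < N" "j' < N" using ij by (auto simp: i'_def j'_def)
  show "twist t A B i j = twist t A B j i"
    using A B ij' unfolding involutive_matrix_def twist_def twist_coeff_def
    by (auto simp: i'_def j'_def)
  have AA: "(\<Sum>k<N. A i' k * A k j') = of_bool (i' = j')" "(\<Sum>k<N. B i' k * B k j') = of_bool (i' = j')"
    using A B ij' unfolding involutive_matrix_def by blast+
  define a b w where "a = (1 + cos t) / 2" and "b = (1 - cos t) / 2" and "w = sin t / 2"
  \<comment> \<open>The symmetric matrix with rows \<open>a, w\<close> and \<open>w, b\<close> has
    trace 1 and determinant 0, hence is a projection. The final computation rests on these two
    identities.\<close>
  have ab: "a + b = 1" "w * w = a * b"
    using sin_cos_squared_add[of t] by (simp_all add: a_def b_def w_def field_simps power2_eq_square)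
  define p0 q0 p1 q1 where "p0 = (if even i then a else w)" "q0 = (if even i then b else - w)"
    "p1 = (if even i then w else b)" "q1 = (if even i then - w else a)"
  define r0 s0 r1 s1 where "r0 = (if even j then a else w)" "s0 = (if even j then b else - w)"
    "r1 = (if even j then w else b)" "s1 = (if even j then - w else a)"
  have row: "twist t A B i (2 * k) = p0 * A i' k + q0 * B i' k"
    "twist t A B i (2 * k + 1) = p1 * A i' k + q1 * B i' k" for k
    by (simp_all add: twist_def twist_coeff_def p0_q0_p1_q1_def a_def b_def w_def i'_def)
  have col: "twist t A B (2 * k) j = r0 * A k j' + s0 * B k j'"
    "twist t A B (2 * k + 1) j = r1 * A k j' + s1 * B k j'" for k
    by (simp_all add: twist_def twist_coeff_def r0_s0_r1_s1_def a_def b_def w_def j'_def)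
  define X Y D :: real where "X = (\<Sum>k<N. A i' k * B k j')" and "Y = (\<Sum>k<N. B i' k * A k j')"
    and "D = of_bool (i' = j')"
  have "i = j \<longleftrightarrow> i' = j' \<and> even i = even j"
    unfolding i'_def j'_def by (metis bit_eq_rec)
  then have D: "of_bool (i = j) = (if even i = even j then D else 0)"
    by (simp add: D_def)
  have "(\<Sum>k<2 * N. twist t A B i k * twist t A B k j) = p0 * r0 * D + p0 * s0 * X + q0 * r0 * Y + q0 * s0 * D
      + (p1 * r1 * D + p1 * s1 * X + q1 * r1 * Y + q1 * s1 * D)"
    unfolding sum_lessThan_double sum.distrib row col sum_bilinear AA X_def Y_def D_def ..
  also have "\<dots> = of_bool (i = j)"
  proof -
    have "a * a * D + a * b * X + b * a * Y + b * b * D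
        + (w * w * D + w * (- w) * X + (- w) * w * Y + (- w) * (- w) * D) = D"
      "a * w * D + a * (- w) * X + b * w * Y + b * (- w) * D
        + (w * b * D + w * a * X + (- w) * b * Y + (- w) * a * D) = 0"
      "w * a * D + w * b * X + (- w) * a * Y + (- w) * b * D
        + (b * w * D + b * (- w) * X + a * w * Y + a * (- w) * D) = 0"
      "w * w * D + w * (- w) * X + (- w) * w * Y + (- w) * (- w) * D
        + (b * b * D + b * a * X + a * b * Y + a * a * D) = D"
      using ab by algebra+
    then show ?thesis
      unfolding D p0_q0_p1_q1_def r0_s0_r1_s1_def
      by (cases "even i"; cases "even j") (simp_all only: if_True if_False simp_thms)
  qed
  finally show "(\<Sum>k<2 * N. twist t A B i k * twist t A B k j) = of_bool (i = j)" .
qed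

text \<open>Both projections of the plane have trace 1.\<close>

lemma trace_twist: "(\<Sum>i<2 * N. twist t A B i i) = (\<Sum>i<N. A i i) + (\<Sum>i<N. B i i)"
  unfolding sum_lessThan_double sum.distrib[symmetric]
  by (intro sum.cong) (simp_all add: twist_def twist_coeff_def field_simps)

section \<open>Lipschitz bounds for the twist\<close>

lemma involutive_matrix_entry_le:
  assumes "involutive_matrix N A" "i < N" "j < N"
  shows "\<bar>A i j\<bar> \<le> 1"
proof -
  have "A i j * A i j \<le> (\<Sum>k<N. A i k * A i k)"
    using assms(3) by (intro member_le_sum) auto
  also have "\<dots> = (\<Sum>k<N. A i k * A k i)"
    using assms unfolding involutive_matrix_def by (intro sum.cong) auto
  also have "\<dots> = of_bool (i = i)" using assms unfolding involutive_matrix_def by blast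
  finally show ?thesis by (simp add: abs_square_le_1 flip: power2_eq_square)
qed

lemma abs_sin_cos_diff_le:
  fixes s t :: real
  shows "\<bar>sin s - sin t\<bar> \<le> \<bar>s - t\<bar>" "\<bar>cos s - cos t\<bar> \<le> \<bar>s - t\<bar>"
proof -
  have 1: "\<bar>2 * x * y\<bar> \<le> \<bar>s - t\<bar>" if "\<bar>y\<bar> \<le> 1" "\<bar>x\<bar> \<le> \<bar>s - t\<bar> / 2" for x y :: real
    using mult_mono[OF that(2,1)] by (simp add: abs_mult)
  show "\<bar>sin s - sin t\<bar> \<le> \<bar>s - t\<bar>"
    unfolding sin_diff_sin using abs_sin_x_le_abs_x[of "(s - t) / 2"] by (intro 1) auto
  have "cos s - cos t = 2 * sin ((t - s) / 2) * sin ((s + t) / 2)"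
    by (simp add: cos_diff_cos)
  then show "\<bar>cos s - cos t\<bar> \<le> \<bar>s - t\<bar>"
    using abs_sin_x_le_abs_x[of "(t - s) / 2"] by (simp only:) (intro 1, auto)
qed

lemma twist_coeff_le: "\<bar>twist_coeff t p q\<bar> \<le> 1"
proof -
  have "\<bar>(1 + x) / 2\<bar> \<le> 1" "\<bar>(1 - x) / 2\<bar> \<le> 1" "\<bar>x / 2\<bar> \<le> 1" if "- 1 \<le> x" "x \<le> 1" for x :: real
    using that by (auto simp: abs_le_iff)
  from this[OF cos_ge_minus_one cos_le_one] this[OF sin_ge_minus_one sin_le_one]
  show ?thesis unfolding twist_coeff_def by presburger
qed

lemma twist_coeff_diff_le: "\<bar>twist_coeff s p q - twist_coeff t p q\<bar> \<le> \<bar>s - t\<bar> / 2"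
  unfolding twist_coeff_def using abs_sin_cos_diff_le[of s t]
  by (auto simp: abs_le_iff field_simps)

text \<open>Coefficients are bounded by 1 and Lipschitz in the angle with constant 1/2, and entries
  of involutive matrices are bounded by 1. Each of the two products thus changes by at most
  \<open>e + \<bar>s - t\<bar> / 2\<close>.\<close>

lemma twist_dist_le:
  assumes "involutive_matrix N A'" "involutive_matrix N B'" "i < 2 * N" "j < 2 * N"
    and AA: "\<And>i j. i < N \<Longrightarrow> j < N \<Longrightarrow> \<bar>A i j - A' i j\<bar> \<le> e"
    and BB: "\<And>i j. i < N \<Longrightarrow> j < N \<Longrightarrow> \<bar>B i j - B' i j\<bar> \<le> e"
  shows "\<bar>twist s A B i j - twist t A' B' i j\<bar> \<le> 2 * e + \<bar>s - t\<bar>"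
proof -
  have *: "\<bar>u * a - u' * a'\<bar> \<le> e + \<bar>s - t\<bar> / 2"
    if "\<bar>u\<bar> \<le> 1" "\<bar>u - u'\<bar> \<le> \<bar>s - t\<bar> / 2" "\<bar>a'\<bar> \<le> 1" "\<bar>a - a'\<bar> \<le> e" for u u' a a' :: real
  proof -
    have "u * a - u' * a' = u * (a - a') + (u - u') * a'" by (simp add: algebra_simps)
    moreover have "\<bar>u * (a - a')\<bar> \<le> 1 * e"
      unfolding abs_mult using that by (intro mult_mono) auto
    moreover have "\<bar>(u - u') * a'\<bar> \<le> \<bar>s - t\<bar> / 2 * 1"
      unfolding abs_mult using that by (intro mult_mono) auto
    ultimately show ?thesis by linarith
  qed
  have sum_diff_le: "\<bar>a + b - (a' + b')\<bar> \<le> 2 * e + \<bar>s - t\<bar>"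
    if "\<bar>a - a'\<bar> \<le> e + \<bar>s - t\<bar> / 2" "\<bar>b - b'\<bar> \<le> e + \<bar>s - t\<bar> / 2" for a b a' b' :: real
  proof -
    have "\<bar>a + b - (a' + b')\<bar> \<le> \<bar>a - a'\<bar> + \<bar>b - b'\<bar>" by linarith
    also have "\<dots> \<le> (e + \<bar>s - t\<bar> / 2) + (e + \<bar>s - t\<bar> / 2)" using that by (rule add_mono)
    finally show ?thesis by simp
  qed
  have ij: "i div 2 < N" "j div 2 < N" using assms(3,4) by auto
  define c where "c t = (if even i = even j then twist_coeff t (odd i) (odd j) else - twist_coeff t (even i) (even j))" for t
  have c: "\<bar>c s\<bar> \<le> 1" "\<bar>c s - c t\<bar> \<le> \<bar>s - t\<bar> / 2"
    using twist_coeff_le twist_coeff_diff_le[of t _ _ s] twist_coeff_diff_le[of s _ _ t] 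
    unfolding c_def by (auto simp: abs_minus_commute)
  have "\<bar>twist_coeff s (even i) (even j) * A (i div 2) (j div 2)
      - twist_coeff t (even i) (even j) * A' (i div 2) (j div 2)\<bar> \<le> e + \<bar>s - t\<bar> / 2"
    using AA ij involutive_matrix_entry_le[OF assms(1)] by (intro * twist_coeff_le twist_coeff_diff_le) auto
  moreover have "\<bar>c s * B (i div 2) (j div 2) - c t * B' (i div 2) (j div 2)\<bar> \<le> e + \<bar>s - t\<bar> / 2"
    using BB ij involutive_matrix_entry_le[OF assms(2)] c by (intro *) auto
  ultimately show ?thesis
    unfolding twist_def c_def[symmetric] by (rule sum_diff_le)
qed

definition neg :: "(nat \<Rightarrow> nat \<Rightarrow> real) \<Rightarrow> nat \<Rightarrow> nat \<Rightarrow> real"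
  where "neg A i j = - A i j"

lemma twist_neg: "twist t (neg A) (neg B) = neg (twist t A B)"
  by (simp add: fun_eq_iff twist_def neg_def)

lemma neg_neg [simp]: "neg (neg A) = A"
  by (simp add: fun_eq_iff neg_def)

lemma involutive_matrix_neg [simp]: "involutive_matrix N (neg A) \<longleftrightarrow> involutive_matrix N A"
  by (simp add: involutive_matrix_def neg_def)

lemma twist_pi: "twist pi A B = twist 0 B A"
  by (auto simp: fun_eq_iff twist_def twist_coeff_def)

text \<open>Trace zero gives the eigenvalues 1 and -1 equal multiplicity.\<close>

definition balanced_matrix :: "nat \<Rightarrow> (nat \<Rightarrow> nat \<Rightarrow> real) \<Rightarrow> bool"
  where "balanced_matrix N A \<longleftrightarrow> involutive_matrix N A \<and> (\<Sum>i<N. A i i) = 0"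

lemma balanced_matrix_neg [simp]: "balanced_matrix N (neg A) \<longleftrightarrow> balanced_matrix N A"
  by (simp add: balanced_matrix_def neg_def sum_negf flip: neg_def[abs_def])

definition small_set :: "nat \<Rightarrow> real \<Rightarrow> (nat \<Rightarrow> nat \<Rightarrow> real) set \<Rightarrow> bool"
  where "small_set N e X \<longleftrightarrow> (\<forall>A\<in>X. balanced_matrix N A) \<and>
    (\<forall>A\<in>X. \<forall>B\<in>X. \<forall>i<N. \<forall>j<N. \<bar>A i j - B i j\<bar> \<le> e)"

lemma small_set_neg: "small_set N e X \<Longrightarrow> small_set N e (neg ` X)"
  unfolding small_set_def by (auto simp: neg_def abs_minus_commute simp flip: neg_def[abs_def])

lemma angle_step_le:
  assumes "i' \<in> {i, Suc i}" "i'' \<in> {i, Suc i}"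
  shows "\<bar>pi * real i' / real n - pi * real i'' / real n\<bar> \<le> pi / real n"
proof -
  have "pi * real i' / real n - pi * real i'' / real n = pi * (real i' - real i'') / real n"
    by (simp add: field_simps diff_divide_distrib)
  moreover have "\<bar>real i' - real i''\<bar> \<le> 1" using assms by auto
  ultimately show ?thesis
    using mult_left_mono[of "\<bar>real i' - real i''\<bar>" 1 pi] by (simp add: abs_mult divide_right_mono)
qed

text \<open>Induction on \<open>l\<close>, starting with a half circle and doubling by
  \<open>antipodal_chains_double\<close>. The bound \<open>e\<close> varies because the step starts
  from simplices of size \<open>e / 3\<close>.\<close>

lemma small_antipodal_chains:
  assumes "e > 0"
  shows "\<exists>c. antipodal_chains neg (small_set (2 ^ Suc l * p) e) (2 ^ Suc l) c"
  using assms
proof (induction l arbitrary: e)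
  case 0
  obtain n :: nat where n: "n > 0" "pi / n < e"
    using reals_Archimedean2[of "pi / e"] 0 pi_gt_zero
    by (metis divide_less_eq mult.commute gr0I of_nat_0 of_nat_0_less_iff less_asym divide_pos_pos)
  define I :: "nat \<Rightarrow> nat \<Rightarrow> real" where "I i j = of_bool (i = j)" for i j
  \<comment> \<open>With \<open>neg I\<close> as second block, the rotation joins a point to its
    antipode. The point and the path are the chains in dimensions 0 and 1.\<close>
  define \<Phi> where "\<Phi> i = twist (pi * real i / real n) I (neg I)" for i
  define c where "c j = (if j = 0 then gen [\<Phi> 0] else push \<Phi> (interval_chain n))" for j :: nat
  have I: "involutive_matrix p I"
    by (auto simp: involutive_matrix_def I_def of_bool_def if_distrib[of "\<lambda>x. _ * x"] cong: if_cong)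
  have tr: "(\<Sum>i<2 * p. \<Phi> j i i) = 0" for j
    unfolding \<Phi>_def trace_twist by (simp add: neg_def sum_negf)
  have \<Phi>: "balanced_matrix (2 * p) (\<Phi> i)" for i
    using involutive_matrix_twist[OF I, of "neg I"] I tr by (simp add: balanced_matrix_def \<Phi>_def)
  have "\<Phi> n = neg (\<Phi> 0)"
    using n twist_pi[of I "neg I"] twist_neg[of 0 I "neg I"] by (simp add: \<Phi>_def)
  then have bd: "bd (push \<Phi> (interval_chain n)) = gen [\<Phi> 0] + push neg (gen [\<Phi> 0])"
    by (simp add: push_bd[symmetric] bd_interval_chain)
  have close: "\<bar>\<Phi> i' a b - \<Phi> i'' a b\<bar> \<le> e"
    if "i' \<in> {i, Suc i}" "i'' \<in> {i, Suc i}" "a < 2 * p" "b < 2 * p" for i i' i'' a b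
  proof -
    have "\<bar>\<Phi> i' a b - \<Phi> i'' a b\<bar> \<le> 2 * 0 + \<bar>pi * real i' / real n - pi * real i'' / real n\<bar>"
      unfolding \<Phi>_def using I that(3,4) by (intro twist_dist_le[where N = p]) auto
    then show ?thesis using angle_step_le[OF that(1,2), of n] n by linarith
  qed
  have small: "small_set (2 * p) e {\<Phi> i, \<Phi> (Suc i)}" for i
    unfolding small_set_def using \<Phi> close[where i = i] 0 by auto
  have "length xs = Suc 1 \<and> small_set (2 * p) e (set xs)" if xs: "xs \<in> Poly_Mapping.keys (push \<Phi> (interval_chain n))" for xs
  proof -
    obtain ks where ks: "xs = map \<Phi> ks" "ks \<in> Poly_Mapping.keys (interval_chain n)"
      using subsetD[OF keys_push xs] by blast
    then obtain i where "ks = [i, Suc i]" using keys_interval_chain by blast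
    then show ?thesis using ks(1) small[of i] by simp
  qed
  moreover have "small_set (2 * p) e {\<Phi> 0}"
    using small[of 0] unfolding small_set_def by auto
  ultimately have "antipodal_chains neg (small_set (2 * p) e) 2 c"
    unfolding antipodal_chains_def using bd by (auto simp: c_def less_2_cases_iff)
  then show ?case by auto
next
  case (Suc l)
  let ?N = "2 ^ Suc l * p"
  \<comment> \<open>By \<open>twist_dist_le\<close> the new simplices have size at most
    \<open>2 * (e / 3) + pi / n\<close>, which is below \<open>e\<close>.\<close>
  obtain n :: nat where n: "n > 0" "pi / n < e / 3"
    using reals_Archimedean2[of "pi / (e / 3)"] Suc.prems pi_gt_zero
    by (metis divide_less_eq mult.commute gr0I of_nat_0 of_nat_0_less_iff less_asym divide_pos_pos zero_less_numeral)
  obtain c where c: "antipodal_chains neg (small_set ?N (e / 3)) (2 ^ Suc l) c"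
    using Suc by fastforce
  define \<Phi> where "\<Phi> i = twist (pi * real i / real n)" for i
  have "\<exists>d. antipodal_chains neg (small_set (2 * ?N) e) (2 * 2 ^ Suc l) d"
  proof (rule antipodal_chains_double[OF c, where \<Phi> = \<Phi> and n = n])
    fix X Y Z i
    assume X: "small_set ?N (e / 3) X" and Y: "small_set ?N (e / 3) Y"
      and Z: "Z \<subseteq> {\<Phi> i' a b | i' a b. i' \<in> {i, Suc i} \<and> a \<in> X \<and> b \<in> Y}"
    show "small_set (2 * ?N) e Z"
      unfolding small_set_def
    proof (intro conjI ballI allI impI)
      fix M assume "M \<in> Z"
      then obtain i' a b where "M = \<Phi> i' a b" "a \<in> X" "b \<in> Y" using Z by blast
      then show "balanced_matrix (2 * ?N) M"
        using X Y unfolding small_set_def balanced_matrix_def \<Phi>_def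
        by (simp only: involutive_matrix_twist trace_twist) simp
    next
      fix M M' r s assume M: "M \<in> Z" "M' \<in> Z" and rs: "r < 2 * ?N" "s < 2 * ?N"
      obtain i' a b where 1: "M = \<Phi> i' a b" "a \<in> X" "b \<in> Y" "i' \<in> {i, Suc i}" using M(1) Z by blast
      obtain i'' a' b' where 2: "M' = \<Phi> i'' a' b'" "a' \<in> X" "b' \<in> Y" "i'' \<in> {i, Suc i}" using M(2) Z by blast
      have "\<bar>M r s - M' r s\<bar> \<le> 2 * (e / 3) + \<bar>pi * real i' / real n - pi * real i'' / real n\<bar>"
        unfolding 1(1) 2(1) \<Phi>_def using 1(2,3) 2(2,3) X Y rs
        unfolding small_set_def balanced_matrix_def by (intro twist_dist_le[where N = ?N]) blast+
      then show "\<bar>M r s - M' r s\<bar> \<le> e" using angle_step_le[OF 1(4) 2(4), of n] n by linarith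
    qed
  qed (use n in \<open>simp_all add: \<Phi>_def twist_neg twist_pi small_set_neg\<close>)
  then show ?case by (simp add: mult.assoc)
qed

text \<open>Otherwise the first coordinate of modulus at least \<open>d\<close>, with its sign, is a
  labelling as in \<open>antipodal_chains_labelling\<close>: complementary labels in one simplex
  would force a jump of at least \<open>2 * d\<close>.\<close>

lemma odd_map_has_small_value:
  fixes f :: "nat \<Rightarrow> (nat \<Rightarrow> nat \<Rightarrow> real) \<Rightarrow> real"
  assumes N: "N = 2 ^ Suc l * p" and "e > 0"
    and odd: "\<And>i A. i < 2 ^ Suc l - 1 \<Longrightarrow> balanced_matrix N A \<Longrightarrow> f i (neg A) = - f i A"
    and close: "\<And>i A B. i < 2 ^ Suc l - 1 \<Longrightarrow> balanced_matrix N A \<Longrightarrow> balanced_matrix N B \<Longrightarrow>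
      (\<And>r s. r < N \<Longrightarrow> s < N \<Longrightarrow> \<bar>A r s - B r s\<bar> \<le> e) \<Longrightarrow> \<bar>f i A - f i B\<bar> < 2 * d"
    and "d > 0"
  shows "\<exists>A. balanced_matrix N A \<and> (\<forall>i<2 ^ Suc l - 1. \<bar>f i A\<bar> < d)"
proof (rule ccontr)
  assume "\<not> ?thesis"
  then have large: "\<exists>i<2 ^ Suc l - 1. \<bar>f i A\<bar> \<ge> d" if "balanced_matrix N A" for A
    using that by force
  define k :: nat where "k = 2 ^ Suc l - 1"
  define idx where "idx A = (LEAST i. i < k \<and> \<bar>f i A\<bar> \<ge> d)" for A
  \<comment> \<open>On balanced matrices the selected value is nonzero, so the second case means a
    negative value.\<close>
  define label where "label A = 2 * idx A + (if f (idx A) A > 0 then 0 else 1)" for A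
  have idx: "idx A < k" "\<bar>f (idx A) A\<bar> \<ge> d" if "balanced_matrix N A" for A
    using LeastI_ex[of "\<lambda>i. i < k \<and> \<bar>f i A\<bar> \<ge> d"] large[OF that] unfolding idx_def k_def by blast+
  have idx_neg: "idx (neg A) = idx A" if "balanced_matrix N A" for A
    unfolding idx_def by (rule arg_cong[where f = Least]) (use odd that in \<open>auto simp: fun_eq_iff k_def\<close>)
  obtain c where c: "antipodal_chains neg (small_set N e) (2 ^ Suc l) c"
    using small_antipodal_chains[OF \<open>e > 0\<close>] N by blast
  have "Suc k = 2 ^ Suc l" by (simp add: k_def)
  show False
  proof (rule antipodal_chains_labelling[OF c[folded \<open>Suc k = _\<close>], of label])
    fix X A assume X: "small_set N e X" "A \<in> X"
    then have A: "balanced_matrix N A" unfolding small_set_def by blast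
    show "label A < 2 * k" using idx(1)[OF A] by (auto simp: label_def)
    have "f (idx A) (neg A) = - f (idx A) A" using odd[of "idx A" A] idx(1)[OF A] A by (simp add: k_def)
    then show "label (neg A) = flip (label A)"
      using idx(2)[OF A] \<open>d > 0\<close> by (auto simp: label_def flip_def idx_neg[OF A])
    fix B assume "B \<in> X"
    then have B: "balanced_matrix N B" using X unfolding small_set_def by blast
    show "label B \<noteq> flip (label A)"
    proof
      assume eq: "label B = flip (label A)"
      then have "label B div 2 = flip (label A) div 2" by simp
      then have idx_eq: "idx B = idx A" by (simp add: label_def flip_def split: if_splits)
      then have "(f (idx A) A > 0) \<noteq> (f (idx A) B > 0)"
        using eq by (auto simp: label_def flip_def split: if_splits)
      then have "\<bar>f (idx A) A - f (idx A) B\<bar> \<ge> 2 * d"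
        using idx(2)[OF A] idx(2)[OF B] unfolding idx_eq by (auto simp: abs_if split: if_splits)
      moreover have "\<bar>f (idx A) A - f (idx A) B\<bar> < 2 * d"
        using X \<open>B \<in> X\<close> idx(1)[OF A] unfolding small_set_def k_def by (intro close A B) auto
      ultimately show False by linarith
    qed
  qed
qed

section \<open>Reflections and their eigenspaces\<close>

text \<open>The typed counterpart of \<open>balanced_matrix\<close>, placed in
  \<open>real^'d^'d\<close> for its topology.\<close>

definition reflections :: "(real^'d^'d) set"
  where "reflections = {A. (\<forall>i j. A $ i $ j = A $ j $ i) \<and>
    (\<forall>i j. (\<Sum>k\<in>UNIV. A $ i $ k * A $ k $ j) = of_bool (i = j)) \<and> (\<Sum>i\<in>UNIV. A $ i $ i) = 0}"

definition fixed_space :: "real^'d^'d \<Rightarrow> (real^'d) set"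
  where "fixed_space A = {x. A *v x = x}"

lemma reflectionsD:
  assumes "A \<in> reflections"
  shows "A $ i $ j = A $ j $ i" "(\<Sum>k\<in>UNIV. A $ i $ k * A $ k $ j) = of_bool (i = j)"
    "(\<Sum>i\<in>UNIV. A $ i $ i) = 0"
  using assms unfolding reflections_def by blast+

lemma reflections_uminus:
  assumes A: "A \<in> reflections"
  shows "- A \<in> reflections"
  unfolding reflections_def
proof (intro CollectI conjI allI)
  show "(- A) $ i $ j = (- A) $ j $ i" for i j
    using reflectionsD(1)[OF A, of i j] by simp
  show "(\<Sum>k\<in>UNIV. (- A) $ i $ k * (- A) $ k $ j) = of_bool (i = j)" for i j
    using reflectionsD(2)[OF A, of i j] by simp
  show "(\<Sum>i\<in>UNIV. (- A) $ i $ i) = 0"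
    using reflectionsD(3)[OF A] by (simp add: sum_negf)
qed

lemma uminus_matrix_vector_mult: "(- A :: real^'d^'n) *v x = - (A *v x)"
  by (simp add: vec_eq_iff matrix_vector_mult_def sum_negf)

lemma reflection_square:
  assumes "A \<in> reflections"
  shows "A *v (A *v x) = x"
proof -
  have "A ** A = mat 1"
    by (simp add: vec_eq_iff matrix_matrix_mult_def mat_def reflectionsD(2)[OF assms])
  then show ?thesis by (simp add: matrix_vector_mul_assoc)
qed

lemma reflection_symmetric:
  assumes "A \<in> reflections"
  shows "(A *v x) \<bullet> y = x \<bullet> (A *v y)"
proof -
  have "transpose A = A" by (simp add: transpose_def vec_eq_iff reflectionsD(1)[OF assms])
  then show ?thesis by (metis dot_lmul_matrix transpose_matrix_vector)
qed

lemma subspace_fixed_space: "subspace (fixed_space A)"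
  unfolding fixed_space_def subspace_def
  by (auto simp: matrix_vector_right_distrib scaleR_matrix_vector_assoc matrix_vector_mult_scaleR)

text \<open>The two vectors are the components of \<open>x\<close> in the eigenspaces for 1 and
  -1.\<close>

lemma reflection_half:
  assumes "A \<in> reflections"
  shows "A *v ((1/2) *\<^sub>R (x + A *v x)) = (1/2) *\<^sub>R (x + A *v x)"
    "A *v ((1/2) *\<^sub>R (x - A *v x)) = - ((1/2) *\<^sub>R (x - A *v x))"
  using reflection_square[OF assms, of x]
  by (simp_all add: matrix_vector_mult_scaleR matrix_vector_right_distrib matrix_vector_mult_diff_distrib algebra_simps)

lemma orth_proj_fixed_space:
  assumes A: "A \<in> reflections"
  shows "orth_proj (fixed_space A) x = (1/2) *\<^sub>R (x + A *v x)"
proof (rule orth_proj_unique[OF subspace_fixed_space])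
  show "(1/2) *\<^sub>R (x + A *v x) \<in> fixed_space A"
    using reflection_half(1)[OF A] by (simp add: fixed_space_def)
  fix z assume "z \<in> fixed_space A"
  then have "(A *v x) \<bullet> z = x \<bullet> z"
    using reflection_symmetric[OF A, of x z] by (simp add: fixed_space_def)
  then show "orthogonal (x - (1/2) *\<^sub>R (x + A *v x)) z"
    by (simp add: orthogonal_def inner_diff_left inner_add_left)
qed

lemma orthogonal_fixed_spaces:
  assumes "A \<in> reflections" "x \<in> fixed_space A" "y \<in> fixed_space (- A)"
  shows "orthogonal x y"
proof -
  have "A *v y = - y"
    using assms(3) by (simp add: fixed_space_def uminus_matrix_vector_mult) (metis minus_minus)
  then show ?thesis
    using reflection_symmetric[OF assms(1), of x y] assms(2) by (simp add: fixed_space_def orthogonal_def)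
qed

text \<open>Expanding \<open>axis i 1\<close> in the eigenbasis writes \<open>A $ i $ i\<close> as a
  weighted sum of squared coordinates. Summed over \<open>i\<close>, each basis vector contributes
  its weight, as its norm is 1.\<close>

lemma trace_orthonormal_basis:
  fixes A :: "real^'d^'d"
  assumes B: "pairwise orthogonal B" "\<And>b. b \<in> B \<Longrightarrow> norm b = 1" "span B = UNIV" "finite B"
    and A: "\<And>b. b \<in> B \<Longrightarrow> A *v b = \<sigma> b *\<^sub>R b"
  shows "(\<Sum>i\<in>UNIV. A $ i $ i) = (\<Sum>b\<in>B. \<sigma> b)"
proof -
  have "A $ i $ i = (\<Sum>b\<in>B. \<sigma> b * (b $ i * b $ i))" for i
  proof -
    have "A $ i $ i = (A *v axis i 1) $ i"
      by (simp add: matrix_vector_mult_basis column_def)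
    also have "axis i 1 = (\<Sum>b\<in>B. (axis i 1 \<bullet> b) *\<^sub>R b)"
      using orthonormal_basis_expand[OF B(1,2) _ B(4), of "axis i 1"] B(3) by simp
    also have "(A *v (\<Sum>b\<in>B. (axis i 1 \<bullet> b) *\<^sub>R b)) $ i = (\<Sum>b\<in>B. b $ i * (A *v b) $ i)"
      by (simp add: linear_sum[OF matrix_vector_mul_linear] matrix_vector_mult_scaleR inner_axis')
    also have "\<dots> = (\<Sum>b\<in>B. \<sigma> b * (b $ i * b $ i))"
      using A by (intro sum.cong) auto
    finally show ?thesis .
  qed
  then have "(\<Sum>i\<in>UNIV. A $ i $ i) = (\<Sum>b\<in>B. \<sigma> b * (\<Sum>i\<in>UNIV. b $ i * b $ i))"
    by (simp add: sum_distrib_left) (rule sum.swap)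
  also have "\<dots> = (\<Sum>b\<in>B. \<sigma> b)"
    using B(2) by (intro sum.cong) (auto simp: norm_eq_1 inner_vec_def)
  finally show ?thesis .
qed

text \<open>Orthonormal bases of the two eigenspaces form a basis of the whole space. The trace of
  the identity gives the sum of the two dimensions, the trace of \<open>A\<close> their
  difference.\<close>

lemma dim_fixed_space:
  fixes A :: "real^'d^'d"
  assumes A: "A \<in> reflections"
  shows "2 * dim (fixed_space A) = CARD('d)"
proof -
  obtain B1 where B1: "B1 \<subseteq> fixed_space A" "pairwise orthogonal B1" "\<And>x. x \<in> B1 \<Longrightarrow> norm x = 1"
    "independent B1" "card B1 = dim (fixed_space A)" "span B1 = fixed_space A"
    using orthonormal_basis_subspace[OF subspace_fixed_space] by metis
  obtain B2 where B2: "B2 \<subseteq> fixed_space (- A)" "pairwise orthogonal B2" "\<And>x. x \<in> B2 \<Longrightarrow> norm x = 1"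
    "independent B2" "card B2 = dim (fixed_space (- A))" "span B2 = fixed_space (- A)"
    using orthonormal_basis_subspace[OF subspace_fixed_space] by metis
  have fin: "finite B1" "finite B2" using B1(4) B2(4) by (simp_all add: independent_imp_finite)
  have disj: "B1 \<inter> B2 = {}"
  proof (rule ccontr)
    assume "B1 \<inter> B2 \<noteq> {}"
    then obtain x where x: "x \<in> B1" "x \<in> B2" by blast
    then have "orthogonal x x" using orthogonal_fixed_spaces[OF A] B1(1) B2(1) by blast
    then show False using B1(3)[OF x(1)] by (simp add: orthogonal_self)
  qed
  have orth: "pairwise orthogonal (B1 \<union> B2)"
  proof (rule pairwiseI)
    fix x y assume xy: "x \<in> B1 \<union> B2" "y \<in> B1 \<union> B2" "x \<noteq> y"
    have "orthogonal u v" if "u \<in> B1" "v \<in> B2" for u v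
      using orthogonal_fixed_spaces[OF A subsetD[OF B1(1) that(1)] subsetD[OF B2(1) that(2)]] .
    then show "orthogonal x y"
      using xy pairwiseD[OF B1(2), of x y] pairwiseD[OF B2(2), of x y] orthogonal_commute[of x y] by blast
  qed
  have "x \<in> span (B1 \<union> B2)" for x
  proof -
    have "(1/2) *\<^sub>R (x + A *v x) \<in> span (B1 \<union> B2)"
      using reflection_half(1)[OF A, of x] span_mono[of B1 "B1 \<union> B2"] B1(6) by (auto simp: fixed_space_def)
    moreover have "(1/2) *\<^sub>R (x - A *v x) \<in> span (B1 \<union> B2)"
      using reflection_half(2)[OF A, of x] span_mono[of B2 "B1 \<union> B2"] B2(6)
      by (auto simp: fixed_space_def uminus_matrix_vector_mult)
    ultimately have "(1/2) *\<^sub>R (x + A *v x) + (1/2) *\<^sub>R (x - A *v x) \<in> span (B1 \<union> B2)"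
      by (rule span_add)
    moreover have "(1/2) *\<^sub>R (x + A *v x) + (1/2) *\<^sub>R (x - A *v x) = x"
      by (simp flip: scaleR_add_right add: scaleR_2[symmetric])
    ultimately show ?thesis by simp
  qed
  then have span: "span (B1 \<union> B2) = UNIV" by blast
  note tr = trace_orthonormal_basis[OF orth _ span]
  have "real CARD('d) = (\<Sum>i\<in>UNIV. (mat 1 :: real^'d^'d) $ i $ i)" by (simp add: mat_def)
  also have "\<dots> = (\<Sum>b\<in>B1 \<union> B2. 1)"
    using B1(3) B2(3) fin by (intro tr) auto
  also have "\<dots> = real (card B1) + real (card B2)" using disj fin by (simp add: card_Un_disjoint)
  finally have 1: "real CARD('d) = real (card B1) + real (card B2)" .
  have "0 = (\<Sum>i\<in>UNIV. A $ i $ i)" using A by (simp add: reflections_def)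
  also have "\<dots> = (\<Sum>b\<in>B1 \<union> B2. if b \<in> B1 then 1 else - 1)"
    using B1(1,3) B2(1,3) fin
    by (intro tr) (auto simp: fixed_space_def uminus_matrix_vector_mult equation_minus_iff subset_iff)
  also have "\<dots> = (\<Sum>b\<in>B1. 1) + (\<Sum>b\<in>B2. - 1)"
    unfolding sum.union_disjoint[OF fin disj]
    by (intro arg_cong2[where f = "(+)"] sum.cong) (use disj in auto)
  finally have "real (card B1) = real (card B2)" by simp
  then show ?thesis using 1 B1(5) by linarith
qed

text \<open>The isometry chosen in \<^const>\<open>value_on\<close> does not depend continuously on the subspace. Coisometries
  onto \<open>\<real>\<^sup>n\<close> with the right kernel form a compact set, and their limits are again of this kind.\<close>

definition coisometry_for :: "real^'d^'d \<Rightarrow> (real^'d) \<Rightarrow>\<^sub>L (real^'n) \<Rightarrow> bool"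
  where "coisometry_for A P \<longleftrightarrow> (\<forall>x. (norm (blinfun_apply P x))\<^sup>2 = x \<bullet> ((1/2) *\<^sub>R (x + A *v x)))"

text \<open>\<open>(I + A) / 2\<close> is symmetric and idempotent. Hence the quadratic form in
  \<open>coisometry_for\<close> is the squared norm of the projection.\<close>

lemma reflection_half_inner:
  assumes "A \<in> reflections"
  shows "x \<bullet> ((1/2) *\<^sub>R (x + A *v x)) = (norm ((1/2) *\<^sub>R (x + A *v x)))\<^sup>2"
  using reflection_square[OF assms, of x] reflection_symmetric[OF assms, of x "A *v x"]
    reflection_symmetric[OF assms, of x x]
  by (simp add: power2_norm_eq_inner inner_add_left inner_add_right inner_commute field_simps)

lemma coisometry_for_exists:
  assumes A: "A \<in> (reflections :: (real^'d^'d) set)" and d: "CARD('d) = 2 * CARD('n)"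
  shows "\<exists>P :: (real^'d) \<Rightarrow>\<^sub>L (real^'n). coisometry_for A P"
proof -
  have "dim (fixed_space A) = DIM(real^'n)" using dim_fixed_space[OF A] d by simp
  then obtain \<phi> :: "real^'d \<Rightarrow> real^'n" where \<phi>: "linear_isometry_on (fixed_space A) \<phi>"
    using linear_isometry_on_exists[OF subspace_fixed_space] by blast
  define \<psi> where "\<psi> x = \<phi> ((1/2) *\<^sub>R (x + A *v x))" for x
  have "linear (\<lambda>x. (1/2) *\<^sub>R (x + A *v x))"
    by (intro linear_compose_scale_right linear_compose_add linear_id[unfolded id_def] matrix_vector_mul_linear)
  then have "linear \<psi>"
    using linear_compose[of _ \<phi>] \<phi> unfolding \<psi>_def[abs_def] linear_isometry_on_def o_def by blast
  then have "bounded_linear \<psi>" by (simp add: linear_conv_bounded_linear)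
  moreover have "norm (\<psi> x) = norm ((1/2) *\<^sub>R (x + A *v x))" for x
    using \<phi> reflection_half(1)[OF A, of x] unfolding linear_isometry_on_def \<psi>_def by (simp add: fixed_space_def)
  ultimately have "coisometry_for A (Blinfun \<psi>)"
    unfolding coisometry_for_def reflection_half_inner[OF A] by (simp only: bounded_linear_Blinfun_apply simp_thms)
  then show ?thesis ..
qed

lemma coisometry_for_norm_le:
  assumes A: "A \<in> reflections" and P: "coisometry_for A P"
  shows "norm P \<le> 1"
proof (rule norm_blinfun_bound)
  fix x
  let ?p = "(1/2) *\<^sub>R (x + A *v x)"
  have "(norm ?p)\<^sup>2 = x \<bullet> ?p" using reflection_half_inner[OF A] by simp
  also have "\<dots> \<le> norm x * norm ?p" by (rule norm_cauchy_schwarz)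
  finally have "norm ?p \<le> norm x"
    by (cases "norm ?p = 0") (auto simp: power2_eq_square mult_le_cancel_right)
  moreover have "(norm (blinfun_apply P x))\<^sup>2 = (norm ?p)\<^sup>2"
    using P unfolding coisometry_for_def reflection_half_inner[OF A] by blast
  then have "norm (blinfun_apply P x) = norm ?p" by (rule power2_eq_imp_eq) simp_all
  ultimately show "norm (blinfun_apply P x) \<le> 1 * norm x" by simp
qed simp

lemma bounded_linear_matrix_vector_mult_left: "bounded_linear (\<lambda>A :: real^'d^'n. A *v x)"
  unfolding linear_conv_bounded_linear[symmetric]
  by (rule linearI) (simp_all add: matrix_vector_mult_add_rdistrib scaleR_matrix_vector_assoc)

text \<open>For each \<open>x\<close> the defining identity equates two continuous functions of
  \<open>A\<close> and \<open>P\<close>.\<close>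

lemma coisometry_for_limit:
  assumes "\<And>m. coisometry_for (A m) (P m)" "A \<longlonglongrightarrow> A0" "P \<longlonglongrightarrow> P0"
  shows "coisometry_for A0 P0"
  unfolding coisometry_for_def
proof
  fix x
  have "(\<lambda>m. (norm (blinfun_apply (P m) x))\<^sup>2) \<longlonglongrightarrow> (norm (blinfun_apply P0 x))\<^sup>2"
    by (intro tendsto_intros assms)
  moreover have "(\<lambda>m. x \<bullet> ((1/2) *\<^sub>R (x + A m *v x))) \<longlonglongrightarrow> x \<bullet> ((1/2) *\<^sub>R (x + A0 *v x))"
    by (intro tendsto_intros bounded_linear.tendsto[OF bounded_linear_matrix_vector_mult_left] assms)
  ultimately show "(norm (blinfun_apply P0 x))\<^sup>2 = x \<bullet> ((1/2) *\<^sub>R (x + A0 *v x))"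
    using assms(1) LIMSEQ_unique unfolding coisometry_for_def by force
qed

lemma linear_image_in_compacts:
  assumes f: "linear f"
  shows "K \<in> nonempty_compacts \<Longrightarrow> f ` K \<in> nonempty_compacts"
    and "K \<in> nonempty_convex_compacts \<Longrightarrow> f ` K \<in> nonempty_convex_compacts"
  using compact_continuous_image[OF linear_continuous_on[OF f[unfolded linear_conv_bounded_linear]], of K]
    convex_linear_image[OF f, of K]
  unfolding nonempty_compacts_def nonempty_convex_compacts_def by auto

text \<open>\<open>P\<close> is isometric on the fixed space and kills the other eigenspace, so
  \<open>K\<close> and its projection have the same image. \<open>value_on_eq\<close> then replaces
  the chosen isometry by \<open>P\<close>.\<close>

lemma value_on_coisometry:
  fixes \<alpha> :: "(real^'n) set \<Rightarrow> real" and K :: "(real^'d) set"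
  assumes A: "A \<in> reflections" and d: "CARD('d) = 2 * CARD('n)"
    and inv: "orth_invariant_on \<C> \<alpha>"
    and \<C>: "\<C> = nonempty_compacts \<and> K \<in> nonempty_compacts
      \<or> \<C> = nonempty_convex_compacts \<and> K \<in> nonempty_convex_compacts"
    and P: "coisometry_for A P"
  shows "value_on \<alpha> (fixed_space A) (orth_proj (fixed_space A) ` K) = \<alpha> (blinfun_apply P ` K)"
proof -
  let ?p = "orth_proj (fixed_space A)"
  have p: "?p = (\<lambda>x. (1/2) *\<^sub>R (x + A *v x))"
    using orth_proj_fixed_space[OF A] by blast
  have lin: "linear ?p"
    unfolding p by (intro linear_compose_scale_right linear_compose_add linear_id[unfolded id_def] matrix_vector_mul_linear)
  have P2: "(norm (blinfun_apply P x))\<^sup>2 = x \<bullet> ((1/2) *\<^sub>R (x + A *v x))" for x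
    using P unfolding coisometry_for_def by blast
  have "linear_isometry_on (fixed_space A) (blinfun_apply P)"
    unfolding linear_isometry_on_def
  proof (intro conjI ballI)
    show "linear (blinfun_apply P)" by (simp add: blinfun.bounded_linear_right linear_conv_bounded_linear)
    fix x assume "x \<in> fixed_space A"
    then have "(norm (blinfun_apply P x))\<^sup>2 = (norm x)\<^sup>2"
      unfolding P2 by (simp add: fixed_space_def power2_norm_eq_inner)
    then show "norm (blinfun_apply P x) = norm x" by simp
  qed
  moreover have "?p ` K \<in> nonempty_compacts \<and> \<C> = nonempty_compacts
      \<or> ?p ` K \<in> nonempty_convex_compacts \<and> \<C> = nonempty_convex_compacts"
    using \<C> linear_image_in_compacts[OF lin] by blast
  ultimately have "value_on \<alpha> (fixed_space A) (?p ` K) = \<alpha> (blinfun_apply P ` ?p ` K)"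
    using d dim_fixed_space[OF A] orth_proj_in[OF subspace_fixed_space, of A]
    by (intro value_on_eq[OF inv _ subspace_fixed_space]) auto
  also have "blinfun_apply P ` ?p ` K = blinfun_apply P ` K"
    unfolding image_image
  proof (rule image_cong)
    fix x
    let ?y = "(1/2) *\<^sub>R (x - A *v x)"
    have "(norm (blinfun_apply P ?y))\<^sup>2 = 0"
      unfolding P2 reflection_half(2)[OF A] by simp
    then have "blinfun_apply P ?y = 0" by simp
    moreover have "x = ?p x + ?y"
      unfolding p by (simp flip: scaleR_add_right add: scaleR_2[symmetric])
    ultimately show "blinfun_apply P (?p x) = blinfun_apply P x"
      by (metis add.right_neutral blinfun.add_right)
  qed simp
  finally show ?thesis .
qed

lemma hausdorff_dist_blinfun_le:
  fixes P Q :: "'a::euclidean_space \<Rightarrow>\<^sub>L 'b::euclidean_space"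
  assumes K: "K \<noteq> {}" "bounded K" and R: "\<And>x. x \<in> K \<Longrightarrow> norm x \<le> R"
  shows "hausdorff_dist (blinfun_apply P ` K) (blinfun_apply Q ` K) \<le> norm (P - Q) * R"
proof -
  have le: "infdist (blinfun_apply P x) (blinfun_apply Q ` K) \<le> norm (P - Q) * R" if "x \<in> K"
    for P Q :: "'a \<Rightarrow>\<^sub>L 'b" and x
  proof -
    have "infdist (blinfun_apply P x) (blinfun_apply Q ` K) \<le> norm (blinfun_apply (P - Q) x)"
      using infdist_le[of "blinfun_apply Q x" "blinfun_apply Q ` K" "blinfun_apply P x"] that
      by (simp add: dist_norm blinfun.diff_left)
    also have "\<dots> \<le> norm (P - Q) * norm x" by (rule norm_blinfun)
    also have "\<dots> \<le> norm (P - Q) * R" using R[OF that] by (intro mult_left_mono) auto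
    finally show ?thesis .
  qed
  show ?thesis
    using K le[of _ P Q] le[of _ Q P]
    by (intro hausdorff_dist_leI) (auto simp: norm_minus_commute intro!: bounded_linear_image blinfun.bounded_linear_right)
qed

text \<open>If values stayed away from the limit along a subsequence, a further subsequence of
  coisometries would converge to one for \<open>A0\<close>, the images of \<open>K\<close> would
  converge in the Hausdorff metric, and continuity of \<open>\<alpha>\<close> gives a
  contradiction.\<close>

lemma continuous_on_value_on:
  fixes \<alpha> :: "(real^'n) set \<Rightarrow> real" and K :: "(real^'d) set"
  assumes d: "CARD('d) = 2 * CARD('n)"
    and inv: "orth_invariant_on \<C> \<alpha>"
    and \<C>: "\<C> = nonempty_compacts \<and> K \<in> nonempty_compacts
      \<or> \<C> = nonempty_convex_compacts \<and> K \<in> nonempty_convex_compacts"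
    and cont: "continuous_map (Metric_space.mtopology \<C> hausdorff_dist) euclideanreal \<alpha>"
  shows "continuous_on reflections (\<lambda>A. value_on \<alpha> (fixed_space A) (orth_proj (fixed_space A) ` K))"
    (is "continuous_on _ ?h")
  unfolding continuous_on_sequentially
proof (intro allI ballI impI)
  fix A A0 assume "A0 \<in> (reflections :: (real^'d^'d) set)"
    and A: "(\<forall>m. A m \<in> reflections) \<and> A \<longlonglongrightarrow> A0"
  have h: "?h B = \<alpha> (blinfun_apply P ` K)" if "B \<in> reflections" "coisometry_for B P" for B and P :: "(real^'d) \<Rightarrow>\<^sub>L (real^'n)"
    using value_on_coisometry[OF that(1) d inv \<C> that(2)] .
  obtain P :: "nat \<Rightarrow> (real^'d) \<Rightarrow>\<^sub>L (real^'n)" where P: "\<And>m. coisometry_for (A m) (P m)"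
    using choice[of "\<lambda>m P. coisometry_for (A m) P"] coisometry_for_exists[OF _ d] A by blast
  interpret Metric_space \<C> hausdorff_dist
    using \<C> Metric_space_nonempty_compacts Metric_space_nonempty_convex_compacts by auto
  have K: "K \<noteq> {}" "bounded K"
    using \<C> unfolding nonempty_compacts_def nonempty_convex_compacts_def by (auto simp: compact_imp_bounded)
  then obtain R where R: "\<And>x. x \<in> K \<Longrightarrow> norm x \<le> R" unfolding bounded_iff by blast
  have img: "blinfun_apply Q ` K \<in> \<C>" for Q :: "(real^'d) \<Rightarrow>\<^sub>L (real^'n)"
  proof -
    have "linear (blinfun_apply Q)" by (simp add: blinfun.bounded_linear_right linear_conv_bounded_linear)
    then show ?thesis using \<C> linear_image_in_compacts by blast
  qed
  show "(?h \<circ> A) \<longlonglongrightarrow> ?h A0"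
  proof (rule ccontr)
    assume "\<not> (?h \<circ> A) \<longlonglongrightarrow> ?h A0"
    then obtain e where e: "e > 0" "\<forall>m. \<exists>n\<ge>m. dist (?h (A n)) (?h A0) \<ge> e"
      unfolding lim_sequentially by (force simp: not_less)
    then have "infinite {n. dist (?h (A n)) (?h A0) \<ge> e}"
      unfolding infinite_nat_iff_unbounded_le by blast
    then obtain r :: "nat \<Rightarrow> nat" where r: "strict_mono r" "\<And>n. dist (?h (A (r n))) (?h A0) \<ge> e"
      using infinite_enumerate by blast
    have "P (r n) \<in> cball 0 1" for n
      using coisometry_for_norm_le[OF _ P] A by simp
    \<comment> \<open>The coisometries lie in the unit ball of a finite-dimensional space of
      operators, which is compact.\<close>
    then obtain P0 s where s: "strict_mono s" "(P \<circ> r \<circ> s) \<longlonglongrightarrow> P0"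
      using compact_cball[of "0 :: (real^'d) \<Rightarrow>\<^sub>L (real^'n)" 1]
      unfolding compact_def by (metis (no_types, lifting) o_apply)
    have "strict_mono (r \<circ> s)" using r(1) s(1) by (rule strict_mono_o)
    then have lim: "(A \<circ> (r \<circ> s)) \<longlonglongrightarrow> A0" using A LIMSEQ_subseq_LIMSEQ by blast
    have P0: "coisometry_for A0 P0"
      by (rule coisometry_for_limit[OF _ lim s(2)]) (simp add: P)
    have "limitin mtopology (\<lambda>n. blinfun_apply ((P \<circ> r \<circ> s) n) ` K) (blinfun_apply P0 ` K) sequentially"
      unfolding limitin_metric
    proof (intro conjI allI impI img)
      fix \<epsilon> :: real assume "\<epsilon> > 0"
      have "(\<lambda>n. norm ((P \<circ> r \<circ> s) n - P0) * R) \<longlonglongrightarrow> norm (P0 - P0) * R"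
        by (intro tendsto_intros s(2))
      then have "\<forall>\<^sub>F n in sequentially. norm ((P \<circ> r \<circ> s) n - P0) * R < \<epsilon>"
        using \<open>\<epsilon> > 0\<close> by (intro order_tendstoD(2)) auto
      then show "\<forall>\<^sub>F n in sequentially. blinfun_apply ((P \<circ> r \<circ> s) n) ` K \<in> \<C> \<and>
          hausdorff_dist (blinfun_apply ((P \<circ> r \<circ> s) n) ` K) (blinfun_apply P0 ` K) < \<epsilon>"
      proof eventually_elim
        case (elim n)
        then show ?case
          using hausdorff_dist_blinfun_le[OF K R, of "(P \<circ> r \<circ> s) n" P0] img by fastforce
      qed
    qed
    then have "(\<lambda>n. \<alpha> (blinfun_apply ((P \<circ> r \<circ> s) n) ` K)) \<longlonglongrightarrow> \<alpha> (blinfun_apply P0 ` K)"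
      using continuous_map_limit[OF cont] by (simp add: o_def)
    then have "(\<lambda>n. ?h (A (r (s n)))) \<longlonglongrightarrow> ?h A0"
      using h[OF \<open>A0 \<in> _\<close> P0] h[OF _ P] A by simp
    then obtain n where "dist (?h (A (r (s n)))) (?h A0) < e"
      using e(1) unfolding lim_sequentially by blast
    then show False using r(2)[of "s n"] by simp
  qed
qed

section \<open>Zeros of odd maps on the space of reflections\<close>

lemma norm_matrix_le: "norm (A :: real^'d^'n) \<le> (\<Sum>i\<in>UNIV. \<Sum>j\<in>UNIV. \<bar>A $ i $ j\<bar>)"
proof -
  have "norm A \<le> (\<Sum>i\<in>UNIV. norm (A $ i))" unfolding norm_vec_def by (rule L2_set_le_sum) simp
  also have "\<dots> \<le> (\<Sum>i\<in>UNIV. \<Sum>j\<in>UNIV. \<bar>A $ i $ j\<bar>)" by (intro sum_mono norm_le_l1_cart)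
  finally show ?thesis .
qed

lemma norm_matrix_le_bound:
  assumes "\<And>i j. \<bar>(A :: real^'d^'n) $ i $ j\<bar> \<le> b"
  shows "norm A \<le> real CARD('n) * (real CARD('d) * b)"
proof -
  have "(\<Sum>i\<in>UNIV. \<Sum>j\<in>UNIV. \<bar>A $ i $ j\<bar>) \<le> (\<Sum>i\<in>(UNIV::'n set). \<Sum>j\<in>(UNIV::'d set). b)"
    by (intro sum_mono assms)
  then show ?thesis using norm_matrix_le[of A] by simp
qed

lemma compact_reflections: "compact (reflections :: (real^'d^'d) set)"
proof -
  have "\<bar>A $ i $ j\<bar> \<le> 1" if "A \<in> (reflections :: (real^'d^'d) set)" for A i j
  proof -
    have "A $ i $ j * A $ i $ j \<le> (\<Sum>k\<in>UNIV. A $ i $ k * A $ i $ k)" by (intro member_le_sum) auto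
    also have "\<dots> = (\<Sum>k\<in>UNIV. A $ i $ k * A $ k $ i)"
      by (intro sum.cong) (simp_all add: reflectionsD(1)[OF that, of i])
    also have "\<dots> = 1" by (simp add: reflectionsD(2)[OF that])
    finally show ?thesis by (simp add: abs_square_le_1 flip: power2_eq_square)
  qed
  then have "bounded (reflections :: (real^'d^'d) set)"
    using norm_matrix_le_bound[of _ 1] unfolding bounded_iff by blast
  moreover have "closed (reflections :: (real^'d^'d) set)"
    unfolding reflections_def
    by (intro closed_Collect_conj closed_Collect_all closed_Collect_eq continuous_intros)
  ultimately show ?thesis by (simp add: compact_eq_bounded_closed)
qed

text \<open>Uniform continuity on the compact space makes \<open>odd_map_has_small_value\<close>
  applicable for every bound. A limit point of matrices with ever smaller values is a zero.\<close>

lemma odd_map_on_reflections_has_zero: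
  fixes f :: "nat \<Rightarrow> real^'d^'d \<Rightarrow> real"
  assumes d: "CARD('d) = 2 ^ Suc l * p"
    and cont: "\<And>i. i < 2 ^ Suc l - 1 \<Longrightarrow> continuous_on reflections (f i)"
    and odd: "\<And>i A. i < 2 ^ Suc l - 1 \<Longrightarrow> A \<in> reflections \<Longrightarrow> f i (- A) = - f i A"
  shows "\<exists>A\<in>reflections. \<forall>i<2 ^ Suc l - 1. f i A = 0"
proof -
  define N k where "N = CARD('d)" and "k = (2 ^ Suc l - 1 :: nat)"
  obtain b :: "'d \<Rightarrow> nat" where "bij_betw b UNIV {0..<CARD('d)}"
    using ex_bij_betw_finite_nat[of "UNIV :: 'd set"] by auto
  then have b: "bij_betw b UNIV {..<N}" by (simp add: N_def atLeast0LessThan)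
  \<comment> \<open>The numbering \<open>b\<close> of the index type carries balanced matrices of
    size \<open>N\<close> to reflections.\<close>
  define M where "M B = (\<chi> i j. B (b i) (b j))" for B :: "nat \<Rightarrow> nat \<Rightarrow> real"
  have bN: "b i < N" for i using b by (auto simp: bij_betw_def)
  have binj: "b i = b j \<longleftrightarrow> i = j" for i j using b by (auto simp: bij_betw_def inj_on_def)
  have sum_b: "(\<Sum>i\<in>UNIV. g (b i)) = (\<Sum>i<N. g i)" for g :: "nat \<Rightarrow> real"
    using sum.reindex_bij_betw[OF b] .
  have M_refl: "M B \<in> reflections" if "balanced_matrix N B" for B
  proof -
    have *: "B r s = B s r" "(\<Sum>k<N. B r k * B k s) = of_bool (r = s)" if "r < N" "s < N" for r s
      using \<open>balanced_matrix N B\<close> that unfolding balanced_matrix_def involutive_matrix_def by blast+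
    have "(\<Sum>k\<in>UNIV. M B $ i $ k * M B $ k $ j) = of_bool (i = j)" for i j
      using sum_b[of "\<lambda>k. B (b i) k * B k (b j)"] *(2)[OF bN bN, of i j] by (simp add: M_def binj)
    moreover have "M B $ i $ j = M B $ j $ i" for i j
      using *(1)[OF bN bN, of i j] by (simp add: M_def)
    moreover have "(\<Sum>i\<in>UNIV. M B $ i $ i) = 0"
      using sum_b[of "\<lambda>i. B i i"] that by (simp add: M_def balanced_matrix_def)
    ultimately show ?thesis unfolding reflections_def by blast
  qed
  have M_neg: "M (neg B) = - M B" for B
    by (simp add: M_def neg_def vec_eq_iff)
  have small: "\<exists>A\<in>reflections. \<forall>i<k. \<bar>f i A\<bar> < \<delta>" if "\<delta> > 0" for \<delta>
  proof -
    have "\<exists>\<eta>>0. \<forall>A\<in>reflections. \<forall>B\<in>reflections. dist A B < \<eta> \<longrightarrow> \<bar>f i A - f i B\<bar> < 2 * \<delta>" if "i < k" for i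
      using compact_uniformly_continuous[OF cont compact_reflections, of i] that \<open>\<delta> > 0\<close>
      unfolding uniformly_continuous_on_def k_def dist_real_def
      by (metis abs_minus_commute dist_commute mult_pos_pos zero_less_numeral)
    then obtain \<eta> where \<eta>: "\<And>i. i < k \<Longrightarrow> \<eta> i > 0"
      "\<And>i A B. i < k \<Longrightarrow> A \<in> reflections \<Longrightarrow> B \<in> reflections \<Longrightarrow> dist A B < \<eta> i \<Longrightarrow> \<bar>f i A - f i B\<bar> < 2 * \<delta>"
      by metis
    define \<eta>0 where "\<eta>0 = Min (insert 1 (\<eta> ` {..<k}))"
    have \<eta>0: "\<eta>0 > 0" "\<And>i. i < k \<Longrightarrow> \<eta>0 \<le> \<eta> i"
      using \<eta>(1) unfolding \<eta>0_def by auto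
    \<comment> \<open>Entrywise distance \<open>e\<close> gives norm at most
      \<open>N * (N * e)\<close>, which is half of \<open>\<eta>0\<close>.\<close>
    define e where "e = \<eta>0 / (2 * real N * real N)"
    have N: "real N > 0" by (simp add: N_def)
    have e: "e > 0" "real N * (real N * e) < \<eta>0"
      using \<eta>0(1) N by (simp_all add: e_def field_simps)
    have "\<exists>B. balanced_matrix N B \<and> (\<forall>i<2 ^ Suc l - 1. \<bar>f i (M B)\<bar> < \<delta>)"
    proof (rule odd_map_has_small_value[where e = e and p = p])
      fix i :: nat and A B assume i: "i < 2 ^ Suc l - 1" and AB: "balanced_matrix N A" "balanced_matrix N B"
        and close: "\<And>r s. r < N \<Longrightarrow> s < N \<Longrightarrow> \<bar>A r s - B r s\<bar> \<le> e"
      have "norm (M A - M B) \<le> real N * (real N * e)"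
        unfolding N_def using close bN by (intro norm_matrix_le_bound) (simp add: M_def)
      then have "dist (M A) (M B) < \<eta> i"
        using e(2) \<eta>0(2)[of i] i by (simp add: dist_norm k_def)
      then show "\<bar>f i (M A) - f i (M B)\<bar> < 2 * \<delta>"
        using i AB M_refl by (intro \<eta>(2)) (auto simp: k_def)
    next
      fix i :: nat and B assume "i < 2 ^ Suc l - 1" "balanced_matrix N B"
      then show "f i (M (neg B)) = - f i (M B)" using odd M_refl by (simp add: M_neg)
    qed (use d e(1) \<open>\<delta> > 0\<close> in \<open>auto simp: N_def\<close>)
    then show ?thesis using M_refl unfolding k_def by blast
  qed
  then have "\<exists>A\<in>reflections. \<forall>i<k. \<bar>f i A\<bar> < inverse (real (Suc m))" for m
    by simp
  then obtain A where A: "\<And>m. A m \<in> reflections" "\<And>m i. i < k \<Longrightarrow> \<bar>f i (A m)\<bar> < inverse (real (Suc m))"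
    by metis
  obtain A0 r where r: "A0 \<in> reflections" "strict_mono r" "(A \<circ> r) \<longlonglongrightarrow> A0"
    using compact_reflections A(1) unfolding compact_def by metis
  have "f i A0 = 0" if "i < k" for i
  proof (rule LIMSEQ_unique)
    show "(f i \<circ> (A \<circ> r)) \<longlonglongrightarrow> f i A0"
      using cont[of i] that r A(1) unfolding continuous_on_sequentially k_def by simp
    have "(\<lambda>m. f i (A m)) \<longlonglongrightarrow> 0"
      using A(2)[OF that] by (intro tendsto_rabs_zero_cancel[OF tendsto_sandwich[OF _ _ tendsto_const LIMSEQ_inverse_real_of_nat]])
        (auto intro!: always_eventually less_imp_le)
    then show "(f i \<circ> (A \<circ> r)) \<longlonglongrightarrow> 0"
      using LIMSEQ_subseq_LIMSEQ[OF _ r(2)] by (fastforce simp: o_def)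
  qed
  then show ?thesis using r(1) unfolding k_def by blast
qed

theorem corollary2:
  fixes l m k :: nat
    and \<C> :: "(real^'n) set set"
    and \<alpha> :: "nat \<Rightarrow> (real^'n) set \<Rightarrow> real"
    and K :: "(real^'d) set"
  assumes "CARD('n) = 2 ^ l * (2 * m + 1)"
    and "CARD('d) = 2 * CARD('n)"
    and "k = 2 ^ (l + 1) - 1"
    and "\<C> = nonempty_compacts \<and> K \<in> nonempty_compacts
      \<or> \<C> = nonempty_convex_compacts \<and> K \<in> nonempty_convex_compacts"
    and "\<And>i. i \<in> {1..k} \<Longrightarrow>
      continuous_map (Metric_space.mtopology \<C> hausdorff_dist) euclideanreal (\<alpha> i)"
    and "\<And>i. i \<in> {1..k} \<Longrightarrow> orth_invariant_on \<C> (\<alpha> i)"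
  shows "\<exists>L M :: (real^'d) set.
    subspace L \<and> subspace M \<and> dim L = CARD('n) \<and> dim M = CARD('n) \<and>
    (\<forall>x\<in>L. \<forall>y\<in>M. orthogonal x y) \<and>
    (\<forall>i\<in>{1..k}. value_on (\<alpha> i) L (orth_proj L ` K) = value_on (\<alpha> i) M (orth_proj M ` K))"
proof -
  define h where "h i A = value_on (\<alpha> i) (fixed_space A) (orth_proj (fixed_space A) ` K)" for i A
  \<comment> \<open>The fixed space of \<open>- A\<close> is the eigenspace of \<open>A\<close> for
    -1, so negation exchanges the two subspaces and \<open>f\<close> is odd. The shift by
    \<open>Suc\<close> matches indices starting at 0 with those starting at 1.\<close>
  define f where "f i A = h (Suc i) A - h (Suc i) (- A)" for i A
  have "\<exists>A\<in>reflections. \<forall>i<2 ^ Suc l - 1. f i A = 0"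
  proof (rule odd_map_on_reflections_has_zero)
    show "CARD('d) = 2 ^ Suc l * (2 * m + 1)" using assms(1,2) by simp
    fix i :: nat assume i: "i < 2 ^ Suc l - 1"
    then have "Suc i \<in> {1..k}" using assms(3) by auto
    then have h: "continuous_on reflections (h (Suc i))"
      using continuous_on_value_on[OF assms(2,6,4,5)] unfolding h_def[abs_def] by blast
    then have "continuous_on reflections (\<lambda>A. h (Suc i) (- A))"
      by (rule continuous_on_compose2) (auto intro!: continuous_intros reflections_uminus)
    then show "continuous_on reflections (f i)"
      unfolding f_def[abs_def] using h by (intro continuous_intros)
  qed (simp add: f_def)
  then obtain A where A: "A \<in> reflections" "\<And>i. i < 2 ^ Suc l - 1 \<Longrightarrow> f i A = 0" by blast
  have "h i A = h i (- A)" if "i \<in> {1..k}" for i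
    using A(2)[of "i - 1"] that assms(3) by (cases i) (auto simp: f_def)
  moreover have "dim (fixed_space A) = CARD('n)" "dim (fixed_space (- A)) = CARD('n)"
    using dim_fixed_space[OF A(1)] dim_fixed_space[OF reflections_uminus[OF A(1)]] assms(2) by simp_all
  ultimately show ?thesis
    using orthogonal_fixed_spaces[OF A(1)] subspace_fixed_space unfolding h_def by blast
qed

end
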